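(* Let $G$ be a second countable compact abelian group and let $A:G\to G$ be a continuous surjective group homomorphism such that $\ker A$ is finite and $\bigcup_{j\in\mathbb{N}_0}\ker A^j$ is dense in $G$; let $m=|\ker A|$. Suppose that $(V_j)_{j\in\mathbb{N}_0}$ is an MSF MRA of $L^2(G)$ associated with $(G,A)$. Then there exist wavelet functions $\psi^\nu_j\in L^2(G)$, $j\in\mathbb{N}_0$, $\nu=1,\ldots,m-1$, and spaces $W^{(\nu)}_j\subset L^2(G)$ such that for all $j\in\mathbb{N}_0$ the system $(T_a\psi^\nu_j)_{a\in\ker A^j}$ is an orthonormal basis of $W^{(\nu)}_j$ for each $\nu=1,\ldots,m-1$, $$V_{j+1}=V_j\oplus W^{(1)}_j\oplus\cdots\oplus W^{(m-1)}_j$$ (orthogonal direct sum), and each $\psi^\nu_j$ has minimal support in frequency: $$|\operatorname{supp}\widehat{\psi}^\nu_j|=m^j\qquad\text{for all } j\in\mathbb{N}_0,\ \nu=1,\ldots,m-1.$$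
   Context: $\mathbb{N}_0=\{0,1,2,\ldots\}$, and $A^0$ is the identity map. $\widehat{G}$ is the (discrete) dual group of continuous characters of $G$; $dx$ is Haar measure on $G$ normalized to total mass $1$, functions are complex-valued, $\widehat{f}(\chi)=\int_G f(x)\overline{\chi(x)}\,dx$, and $\operatorname{supp}\widehat{f}=\{\chi\in\widehat{G}:\widehat{f}(\chi)\neq 0\}$. Translation: $T_yf(x)=f(x-y)$, $y\in G$. Periodization: $Pf(x)=\sum_{a\in\ker A}f(y+a)$, where $y\in G$ is any element with $Ay=x$. An MRA of $L^2(G)$ associated with $(G,A)$ is a sequence $(V_j)_{j\in\mathbb{N}_0}$ of closed subspaces of $L^2(G)$ such that: MR1. $V_j\subset V_{j+1}$ for all $j\in\mathbb{N}_0$; MR2. $\overline{\bigcup_{j=0}^\infty V_j}=L^2(G)$; MR3. for all $j\in\mathbb{N}_0$ and $\gamma\in\ker A^j$, $f\in V_j$ if and only if $T_\gamma f\in V_j$; MR4. for each $j\in\mathbb{N}_0$ there exists $\varphi_j\in V_j$ such that $(T_a\varphi_j)_{a\in\ker A^j}$ is a basis of $V_j$; MR5. for all $j\in\mathbb{N}_0$: a) $f\in V_j\Rightarrow f(A(\cdot))\in V_{j+1}$, and b) $f\in V_{j+1}\Rightarrow Pf\in V_j$. A sequence $(\varphi_j)$ as in MR4 is a scaling sequence of the MRA. An MRA $(V_j)_{j\in\mathbb{N}_0}$ is called MSF (minimally supported frequency) if its scaling sequence $(\varphi_j)_{j\in\mathbb{N}_0}$ satisfies $|\operatorname{supp}\widehat{\varphi}_j|=m^j$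 for all $j\in\mathbb{N}_0$. *)

theory Defs
  imports "HOL-Analysis.Analysis"
begin

section \<open>Haar measure and characters\<close>

text \<open>
  A compact abelian group is a type of class topological_ab_group_add and t2_space whose universe
  is compact.  The library has no Haar measure, so it enters as a measure M that satisfies the
  defining properties.  Regularity is not listed: on a second countable compact Hausdorff space
  every finite Borel measure is regular.
\<close>

definition normalized_haar :: "'a::topological_ab_group_add measure \<Rightarrow> bool" where
  "normalized_haar M \<longleftrightarrow>
     sets M = sets borel \<and> emeasure M UNIV = 1 \<and> (\<forall>y. distr M M (\<lambda>x. y + x) = M)"

definition dual_group :: "('a::topological_ab_group_add \<Rightarrow> complex) set" where
  "dual_group = {\<xi>. continuous_on UNIV \<xi> \<and> (\<forall>x. cmod (\<xi> x) = 1) \<and>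
                    (\<forall>x y. \<xi> (x + y) = \<xi> x * \<xi> y)}"

definition fourier_coeff :: "'a measure \<Rightarrow> ('a \<Rightarrow> complex) \<Rightarrow> ('a \<Rightarrow> complex) \<Rightarrow> complex" where
  "fourier_coeff M f \<xi> = (LINT x|M. f x * cnj (\<xi> x))"

definition freq_supp ::
    "'a::topological_ab_group_add measure \<Rightarrow> ('a \<Rightarrow> complex) \<Rightarrow> ('a \<Rightarrow> complex) set" where
  "freq_supp M f = {\<xi> \<in> dual_group. fourier_coeff M f \<xi> \<noteq> 0}"


section \<open>The space of square integrable functions\<close>

text \<open>
  Elements of the Hilbert space are represented by functions rather than by classes modulo
  equality almost everywhere, so a set of classes becomes a set of functions that is closed under
  almost everywhere equality.  A closed set (in the sense of the seminorm) always has this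
  property, and so has a span.
\<close>

definition L2 :: "'a measure \<Rightarrow> ('a \<Rightarrow> complex) set" where
  "L2 M = {f \<in> borel_measurable M. integrable M (\<lambda>x. (cmod (f x))\<^sup>2)}"

definition L2_inner :: "'a measure \<Rightarrow> ('a \<Rightarrow> complex) \<Rightarrow> ('a \<Rightarrow> complex) \<Rightarrow> complex" where
  "L2_inner M f g = (LINT x|M. f x * cnj (g x))"

definition L2_norm :: "'a measure \<Rightarrow> ('a \<Rightarrow> complex) \<Rightarrow> real" where
  "L2_norm M f = sqrt (LINT x|M. (cmod (f x))\<^sup>2)"

definition L2_closure :: "'a measure \<Rightarrow> ('a \<Rightarrow> complex) set \<Rightarrow> ('a \<Rightarrow> complex) set" where
  "L2_closure M S = {f \<in> L2 M. \<forall>\<epsilon>>0. \<exists>g\<in>S. L2_norm M (\<lambda>x. f x - g x) < \<epsilon>}"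

definition L2_subspace :: "'a measure \<Rightarrow> ('a \<Rightarrow> complex) set \<Rightarrow> bool" where
  "L2_subspace M S \<longleftrightarrow> S \<subseteq> L2 M \<and> (\<lambda>x. 0) \<in> S \<and>
     (\<forall>f\<in>S. \<forall>g\<in>S. (\<lambda>x. f x + g x) \<in> S) \<and> (\<forall>c. \<forall>f\<in>S. (\<lambda>x. c * f x) \<in> S)"

definition L2_closed_subspace :: "'a measure \<Rightarrow> ('a \<Rightarrow> complex) set \<Rightarrow> bool" where
  "L2_closed_subspace M S \<longleftrightarrow> L2_subspace M S \<and> L2_closure M S = S"

text \<open>Only finite families are needed, so spans and bases are the algebraic ones.\<close>

definition L2_span :: "'a measure \<Rightarrow> 'i set \<Rightarrow> ('i \<Rightarrow> 'a \<Rightarrow> complex) \<Rightarrow> ('a \<Rightarrow> complex) set" where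
  "L2_span M I e = {f \<in> L2 M. \<exists>c. AE x in M. f x = (\<Sum>i\<in>I. c i * e i x)}"

definition L2_basis ::
    "'a measure \<Rightarrow> ('a \<Rightarrow> complex) set \<Rightarrow> 'i set \<Rightarrow> ('i \<Rightarrow> 'a \<Rightarrow> complex) \<Rightarrow> bool" where
  "L2_basis M S I e \<longleftrightarrow> finite I \<and> (\<forall>i\<in>I. e i \<in> L2 M) \<and>
     (\<forall>c. (AE x in M. (\<Sum>i\<in>I. c i * e i x) = 0) \<longrightarrow> (\<forall>i\<in>I. c i = 0)) \<and>
     S = L2_span M I e"

definition L2_orthonormal_basis ::
    "'a measure \<Rightarrow> ('a \<Rightarrow> complex) set \<Rightarrow> 'i set \<Rightarrow> ('i \<Rightarrow> 'a \<Rightarrow> complex) \<Rightarrow> bool" where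
  "L2_orthonormal_basis M S I e \<longleftrightarrow> finite I \<and> (\<forall>i\<in>I. e i \<in> L2 M) \<and>
     (\<forall>i\<in>I. \<forall>k\<in>I. L2_inner M (e i) (e k) = (if i = k then 1 else 0)) \<and>
     S = L2_span M I e"

definition L2_orthogonal_sum ::
    "'a measure \<Rightarrow> ('a \<Rightarrow> complex) set \<Rightarrow> 'i set \<Rightarrow> ('i \<Rightarrow> ('a \<Rightarrow> complex) set) \<Rightarrow> bool" where
  "L2_orthogonal_sum M S I U \<longleftrightarrow> finite I \<and> (\<forall>i\<in>I. L2_subspace M (U i)) \<and>
     (\<forall>i\<in>I. \<forall>k\<in>I. i \<noteq> k \<longrightarrow> (\<forall>f\<in>U i. \<forall>g\<in>U k. L2_inner M f g = 0)) \<and>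
     S = {(\<lambda>x. \<Sum>i\<in>I. h i x) | h. \<forall>i\<in>I. h i \<in> U i}"


section \<open>Multiresolution analysis\<close>

definition ker_pow :: "('a::ab_group_add \<Rightarrow> 'a) \<Rightarrow> nat \<Rightarrow> 'a set" where
  "ker_pow A j = {x. (A ^^ j) x = 0}"

definition translate :: "'a::ab_group_add \<Rightarrow> ('a \<Rightarrow> complex) \<Rightarrow> 'a \<Rightarrow> complex" where
  "translate y f = (\<lambda>x. f (x - y))"

definition periodize :: "('a::ab_group_add \<Rightarrow> 'a) \<Rightarrow> ('a \<Rightarrow> complex) \<Rightarrow> 'a \<Rightarrow> complex" where
  "periodize A f = (\<lambda>x. \<Sum>a\<in>ker_pow A 1. f ((SOME y. A y = x) + a))"

lemma periodize_apply:
  fixes A :: "'a::ab_group_add \<Rightarrow> 'a"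
  assumes "Modules.additive A"
  shows "periodize A f (A y) = (\<Sum>a\<in>ker_pow A 1. f (y + a))"
proof -
  interpret Modules.additive A by fact
  define z where "z = (SOME z. A z = A y)"
  have z: "A z = A y" unfolding z_def by (rule someI) simp
  have "(\<Sum>a\<in>ker_pow A 1. f (z + a)) = (\<Sum>a\<in>ker_pow A 1. f (y + a))"
    by (rule sum.reindex_bij_witness[where i = "\<lambda>a. y + a - z" and j = "\<lambda>a. z + a - y"])
       (auto simp: ker_pow_def add diff z)
  then show ?thesis by (simp add: periodize_def z_def)
qed

definition scaling_sequence ::
    "'a::topological_ab_group_add measure \<Rightarrow> ('a \<Rightarrow> 'a) \<Rightarrow> (nat \<Rightarrow> ('a \<Rightarrow> complex) set) \<Rightarrow>
     (nat \<Rightarrow> 'a \<Rightarrow> complex) \<Rightarrow> bool" where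
  "scaling_sequence M A V \<phi> \<longleftrightarrow>
     (\<forall>j. \<phi> j \<in> V j \<and> L2_basis M (V j) (ker_pow A j) (\<lambda>a. translate a (\<phi> j)))"

definition MRA ::
    "'a::topological_ab_group_add measure \<Rightarrow> ('a \<Rightarrow> 'a) \<Rightarrow> (nat \<Rightarrow> ('a \<Rightarrow> complex) set) \<Rightarrow> bool" where
  "MRA M A V \<longleftrightarrow>
     (\<forall>j. L2_closed_subspace M (V j)) \<and>
     (\<forall>j. V j \<subseteq> V (Suc j)) \<and>
     L2_closure M (\<Union>j. V j) = L2 M \<and>
     (\<forall>j. \<forall>\<gamma>\<in>ker_pow A j. \<forall>f\<in>L2 M. f \<in> V j \<longleftrightarrow> translate \<gamma> f \<in> V j) \<and>
     (\<exists>\<phi>. scaling_sequence M A V \<phi>) \<and>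
     (\<forall>j. \<forall>f\<in>V j. (\<lambda>x. f (A x)) \<in> V (Suc j)) \<and>
     (\<forall>j. \<forall>f\<in>V (Suc j). periodize A f \<in> V j)"

text \<open>
  The support condition is asked of some scaling sequence, which is the weakest reading of "its
  scaling sequence".  Since the right-hand side is positive for a finite kernel, the equation of
  cardinalities includes finiteness of the supports.
\<close>

definition MSF_MRA ::
    "'a::topological_ab_group_add measure \<Rightarrow> ('a \<Rightarrow> 'a) \<Rightarrow> (nat \<Rightarrow> ('a \<Rightarrow> complex) set) \<Rightarrow> bool" where
  "MSF_MRA M A V \<longleftrightarrow> MRA M A V \<and>
     (\<exists>\<phi>. scaling_sequence M A V \<phi> \<and>
          (\<forall>j. card (freq_supp M (\<phi> j)) = card (ker_pow A 1) ^ j))"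

end

theory Submission
  imports Defs "HOL-Complex_Analysis.Great_Picard"
begin

text \<open>
  The idea is to do everything on the side of frequencies.  Translation by \<open>a\<close> multiplies the
  Fourier coefficient at a character \<open>\<xi>\<close> by the conjugate of \<open>\<xi> a\<close>, so for \<open>a\<close> in the finite group
  \<open>K j = ker_pow A j\<close> it acts on frequencies only through the restriction of \<open>\<xi>\<close> to \<open>K j\<close>.

  Let \<open>S j\<close> be the support of the Fourier transform of \<open>\<phi> j\<close>, a set of \<open>m ^ j\<close> characters;
  \<open>m ^ j\<close> is also the order of \<open>K j\<close>.  If two of them agreed on \<open>K j\<close>, the \<open>m ^ j\<close> translates of \<open>\<phi> j\<close> would be linearly
  dependent (\<open>independent_translates_imp_distinct_on\<close>).  So the characters in \<open>S j\<close> restrict to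
  all the characters of \<open>K j\<close>, finite Fourier inversion recovers each member of \<open>S j\<close> from the
  translates of \<open>\<phi> j\<close>, and \<open>V j\<close> is the space of all trigonometric polynomials with frequencies in
  \<open>S j\<close> (\<open>span_translates_eq_trig_space\<close>).  In particular \<open>S j \<subseteq> S (Suc j)\<close>.

  Now restrict the characters in \<open>S (Suc j)\<close> to the smaller group \<open>K j\<close>.  A counting argument shows
  that every character of \<open>K j\<close> arises from exactly \<open>m\<close> of them, one of which lies in \<open>S j\<close>.  Hence
  \<open>S (Suc j)\<close> is the disjoint union of \<open>m\<close> transversals of the restriction map, with \<open>S j\<close> as the first
  (\<open>ex_transversal_partition\<close>).  The wavelet \<open>\<psi> \<nu> j\<close> is the normalized sum of the characters in the
  \<open>\<nu>\<close>-th transversal: orthogonality on \<open>K j\<close> makes its translates orthonormal, and disjointness of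
  the transversals makes the spaces orthogonal.

  This presupposes that a square integrable function is determined by its Fourier coefficients
  (\<open>fourier_uniqueness\<close>), which follows from Stone-Weierstrass once characters separate the points
  of the group.  That is the abelian Peter-Weyl theorem; here it is proved from the dense increasing
  union of the finite groups \<open>K j\<close>.  For a bump function around \<open>0\<close>, Plancherel on \<open>K j\<close> produces a
  character of \<open>K j\<close> whose coefficient is bounded below and whose value at a point near a given
  \<open>x0 \<noteq> 0\<close> stays away from \<open>1\<close>, both uniformly in \<open>j\<close>.  Large coefficients with respect to a
  uniformly continuous function force these characters to be equicontinuous, so a limit of them
  extends continuously to the whole group (\<open>chars_separate_zero\<close>).
\<close>

section \<open>Orthogonality of characters on finite subgroups\<close>

definition add_subgroup :: "'a::ab_group_add set \<Rightarrow> bool" where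
  "add_subgroup H \<longleftrightarrow> 0 \<in> H \<and> (\<forall>x\<in>H. \<forall>y\<in>H. x - y \<in> H)"

definition char_on :: "'a::ab_group_add set \<Rightarrow> ('a \<Rightarrow> complex) \<Rightarrow> bool" where
  "char_on H \<theta> \<longleftrightarrow> (\<forall>x\<in>H. cmod (\<theta> x) = 1) \<and> (\<forall>x\<in>H. \<forall>y\<in>H. \<theta> (x + y) = \<theta> x * \<theta> y)"

lemma add_subgroup_zero: "add_subgroup H \<Longrightarrow> 0 \<in> H"
  and add_subgroup_diff: "add_subgroup H \<Longrightarrow> x \<in> H \<Longrightarrow> y \<in> H \<Longrightarrow> x - y \<in> H"
  by (auto simp: add_subgroup_def)

lemma add_subgroup_uminus: "add_subgroup H \<Longrightarrow> x \<in> H \<Longrightarrow> - x \<in> H"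
  using add_subgroup_diff[of H 0 x] add_subgroup_zero[of H] by simp

lemma add_subgroup_add: "add_subgroup H \<Longrightarrow> x \<in> H \<Longrightarrow> y \<in> H \<Longrightarrow> x + y \<in> H"
  using add_subgroup_diff[of H x "- y"] add_subgroup_uminus[of H y] by simp

lemmas add_subgroup_closed =
  add_subgroup_zero add_subgroup_diff add_subgroup_uminus add_subgroup_add

lemma char_on_norm: "char_on H \<theta> \<Longrightarrow> x \<in> H \<Longrightarrow> cmod (\<theta> x) = 1"
  and char_on_add: "char_on H \<theta> \<Longrightarrow> x \<in> H \<Longrightarrow> y \<in> H \<Longrightarrow> \<theta> (x + y) = \<theta> x * \<theta> y"
  by (auto simp: char_on_def)

lemma char_on_cnj: "char_on H \<theta> \<Longrightarrow> x \<in> H \<Longrightarrow> \<theta> x * cnj (\<theta> x) = 1"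
  by (simp add: char_on_norm flip: complex_norm_square)

lemma char_on_nonzero: "char_on H \<theta> \<Longrightarrow> x \<in> H \<Longrightarrow> \<theta> x \<noteq> 0"
  using char_on_norm by fastforce

lemma char_on_zero:
  assumes "add_subgroup H" "char_on H \<theta>" shows "\<theta> 0 = 1"
proof -
  have "\<theta> 0 = \<theta> 0 * \<theta> 0"
    using char_on_add[OF assms(2), of 0 0] add_subgroup_zero[OF assms(1)] by simp
  then show ?thesis
    using char_on_nonzero[OF assms(2) add_subgroup_zero[OF assms(1)]] by simp
qed

lemma char_on_diff:
  assumes "add_subgroup H" "char_on H \<theta>" "x \<in> H" "y \<in> H"
  shows "\<theta> (x - y) = \<theta> x * cnj (\<theta> y)"
proof -
  have "\<theta> (x - y) * \<theta> y = \<theta> x"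
    using char_on_add[OF assms(2), of "x - y" y] assms add_subgroup_diff by fastforce
  then show ?thesis
    using char_on_cnj[OF assms(2,4)] by (metis mult.assoc mult.right_neutral)
qed

lemma char_on_mult: "char_on H \<theta> \<Longrightarrow> char_on H \<eta> \<Longrightarrow> char_on H (\<lambda>x. \<theta> x * \<eta> x)"
  by (auto simp: char_on_def norm_mult)

lemma char_on_cnj_mult: "char_on H \<theta> \<Longrightarrow> char_on H \<eta> \<Longrightarrow> char_on H (\<lambda>x. \<theta> x * cnj (\<eta> x))"
  by (auto simp: char_on_def norm_mult)

lemma char_on_subset: "char_on K \<theta> \<Longrightarrow> H \<subseteq> K \<Longrightarrow> char_on H \<theta>"
  by (auto simp: char_on_def)

lemma sum_subgroup_shift:
  assumes "add_subgroup H" "a \<in> H"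
  shows "(\<Sum>x\<in>H. g (x + a)) = (\<Sum>x\<in>H. g x)"
  by (rule sum.reindex_bij_witness[where i = "\<lambda>x. x - a" and j = "\<lambda>x. x + a"])
     (use assms in \<open>auto intro: add_subgroup_closed\<close>)

text \<open>
  Shifting the variable by \<open>a\<close> multiplies the sum by \<open>\<theta> a\<close>, so it vanishes unless \<open>\<theta>\<close> is trivial.
\<close>

lemma sum_char:
  assumes H: "add_subgroup H" and \<theta>: "char_on H \<theta>"
  shows "(\<Sum>x\<in>H. \<theta> x) = (if \<forall>a\<in>H. \<theta> a = 1 then of_nat (card H) else 0)"
proof (cases "\<forall>a\<in>H. \<theta> a = 1")
  case False
  then obtain a where a: "a \<in> H" "\<theta> a \<noteq> 1" by auto
  have "(\<Sum>x\<in>H. \<theta> x) = (\<Sum>x\<in>H. \<theta> (x + a))"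
    by (rule sum_subgroup_shift[symmetric, OF H a(1)])
  also have "\<dots> = \<theta> a * (\<Sum>x\<in>H. \<theta> x)"
    by (simp add: sum_distrib_left char_on_add[OF \<theta> _ a(1)] mult.commute)
  finally show ?thesis using a False by auto
qed auto

lemma char_orthogonality:
  assumes "add_subgroup H" "char_on H \<theta>" "char_on H \<eta>"
  shows "(\<Sum>x\<in>H. \<theta> x * cnj (\<eta> x)) = (if \<forall>a\<in>H. \<theta> a = \<eta> a then of_nat (card H) else 0)"
proof -
  have "\<theta> a * cnj (\<eta> a) = 1 \<longleftrightarrow> \<theta> a = \<eta> a" if "a \<in> H" for a
    using char_on_cnj[OF assms(3) that] char_on_nonzero[OF assms(3) that]
    by (metis complex_cnj_zero_iff mult_cancel_right)
  then show ?thesis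
    using sum_char[OF assms(1) char_on_cnj_mult[OF assms(2,3)]] by auto
qed

text \<open>
  Distinctness of the restrictions to \<open>K\<close>, for characters that live on a larger group.
\<close>

definition distinct_on :: "'a set \<Rightarrow> ('a \<Rightarrow> complex) set \<Rightarrow> bool" where
  "distinct_on K F \<longleftrightarrow> (\<forall>\<theta>\<in>F. \<forall>\<eta>\<in>F. (\<forall>x\<in>K. \<theta> x = \<eta> x) \<longrightarrow> \<theta> = \<eta>)"

lemma distinct_on_subset: "distinct_on K F \<Longrightarrow> F' \<subseteq> F \<Longrightarrow> distinct_on K F'"
  unfolding distinct_on_def by blast

text \<open>
  Parseval's identity for a sum of distinct characters; the two counting lemmas below read off its consequences.
\<close>

lemma sum_norm_square_sum_chars:
  assumes K: "add_subgroup K" and fin: "finite F"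
    and ch: "\<And>\<theta>. \<theta> \<in> F \<Longrightarrow> char_on K \<theta>" and dist: "distinct_on K F"
  shows "(\<Sum>x\<in>K. (cmod (\<Sum>\<theta>\<in>F. \<theta> x))\<^sup>2) = real (card F) * real (card K)"
proof -
  have "complex_of_real (\<Sum>x\<in>K. (cmod (\<Sum>\<theta>\<in>F. \<theta> x))\<^sup>2)
      = (\<Sum>x\<in>K. (\<Sum>\<theta>\<in>F. \<theta> x) * cnj (\<Sum>\<theta>\<in>F. \<theta> x))"
    by (simp only: of_real_sum complex_norm_square)
  also have "\<dots> = (\<Sum>x\<in>K. \<Sum>\<theta>\<in>F. \<Sum>\<eta>\<in>F. \<theta> x * cnj (\<eta> x))"
    by (simp only: cnj_sum sum_product)
  also have "\<dots> = (\<Sum>\<theta>\<in>F. \<Sum>\<eta>\<in>F. \<Sum>x\<in>K. \<theta> x * cnj (\<eta> x))"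
    by (subst sum.swap, rule sum.cong[OF refl], rule sum.swap)
  also have "\<dots> = (\<Sum>\<theta>\<in>F. \<Sum>\<eta>\<in>F. if \<theta> = \<eta> then of_nat (card K) else 0)"
  proof (intro sum.cong refl)
    fix \<theta> \<eta> assume "\<theta> \<in> F" "\<eta> \<in> F"
    moreover from this have "(\<forall>x\<in>K. \<theta> x = \<eta> x) \<longleftrightarrow> \<theta> = \<eta>"
      using dist by (auto simp: distinct_on_def)
    ultimately show "(\<Sum>x\<in>K. \<theta> x * cnj (\<eta> x)) = (if \<theta> = \<eta> then of_nat (card K) else 0)"
      using char_orthogonality[OF K ch ch] by presburger
  qed
  also have "\<dots> = of_nat (card F * card K)"
    using fin by simp
  finally show ?thesis
    by (metis of_nat_mult of_real_eq_iff of_real_of_nat_eq)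
qed

text \<open>
  Such characters differ by characters of \<open>K\<close> modulo \<open>H\<close>, a group with \<open>card K / card H\<close> elements.  The quotient is
  avoided: on \<open>H\<close> the sum of the characters has modulus \<open>card F\<close>, and this share of its square norm
  cannot exceed the whole, which is \<open>card F * card K\<close>.
\<close>

lemma card_chars_agreeing_on_subgroup:
  assumes K: "add_subgroup K" "finite K" and H: "add_subgroup H" "H \<subseteq> K" and fin: "finite F"
    and ch: "\<And>\<theta>. \<theta> \<in> F \<Longrightarrow> char_on K \<theta>" and dist: "distinct_on K F"
    and agree: "\<And>\<theta> \<eta> x. \<theta> \<in> F \<Longrightarrow> \<eta> \<in> F \<Longrightarrow> x \<in> H \<Longrightarrow> \<theta> x = \<eta> x"
  shows "card F * card H \<le> card K"
proof (cases "F = {}")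
  case False
  then obtain \<xi> where \<xi>: "\<xi> \<in> F" by auto
  have on_H: "cmod (\<Sum>\<theta>\<in>F. \<theta> x) = card F" if "x \<in> H" for x
  proof -
    have "(\<Sum>\<theta>\<in>F. \<theta> x) = (\<Sum>\<theta>\<in>F. \<xi> x)"
      using agree \<xi> that by (intro sum.cong) auto
    then show ?thesis
      using char_on_norm[OF ch[OF \<xi>], of x] that H by (auto simp: norm_mult)
  qed
  have "real (card H) * (real (card F))\<^sup>2 = (\<Sum>x\<in>H. (cmod (\<Sum>\<theta>\<in>F. \<theta> x))\<^sup>2)"
    using on_H by simp
  also have "\<dots> \<le> (\<Sum>x\<in>K. (cmod (\<Sum>\<theta>\<in>F. \<theta> x))\<^sup>2)"
    using K H by (intro sum_mono2) auto
  also have "\<dots> = real (card F) * real (card K)"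
    by (rule sum_norm_square_sum_chars[OF K(1) fin ch dist])
  finally have "real (card F) * (real (card F) * real (card H)) \<le> real (card F) * real (card K)"
    by (simp add: power2_eq_square algebra_simps)
  moreover have "real (card F) > 0" using False fin by (simp add: card_gt_0_iff)
  ultimately have "real (card F) * real (card H) \<le> real (card K)"
    by (rule mult_left_le_imp_le)
  then show ?thesis by (metis of_nat_le_iff of_nat_mult)
qed auto

lemma card_chars_le:
  assumes K: "add_subgroup K" "finite K" and fin: "finite F"
    and ch: "\<And>\<theta>. \<theta> \<in> F \<Longrightarrow> char_on K \<theta>" and dist: "distinct_on K F"
  shows "card F \<le> card K"
proof -
  have z: "add_subgroup {0::'a}" "{0} \<subseteq> K"
    using add_subgroup_zero[OF K(1)] by (auto simp: add_subgroup_def)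
  have "\<theta> x = \<eta> x" if "\<theta> \<in> F" "\<eta> \<in> F" "x = 0" for \<theta> \<eta> x
    using that char_on_zero[OF K(1) ch[OF that(1)]] char_on_zero[OF K(1) ch[OF that(2)]] by simp
  with card_chars_agreeing_on_subgroup[of K "{0}" F, OF K z fin _ dist] ch show ?thesis
    by simp
qed

text \<open>
  When there are as many characters as points, the value at \<open>0\<close> alone exhausts the square norm of
  their sum, so the sum vanishes elsewhere.  This is the second orthogonality relation.
\<close>

lemma sum_all_chars:
  assumes K: "add_subgroup K" "finite K" and fin: "finite F"
    and ch: "\<And>\<theta>. \<theta> \<in> F \<Longrightarrow> char_on K \<theta>" and dist: "distinct_on K F"
    and full: "card F = card K" and a: "a \<in> K"
  shows "(\<Sum>\<theta>\<in>F. \<theta> a) = (if a = 0 then of_nat (card K) else 0)"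
proof -
  have s0: "(\<Sum>\<theta>\<in>F. \<theta> 0) = of_nat (card K)"
    by (simp add: char_on_zero[OF K(1) ch] full)
  have "(\<Sum>x\<in>K. (cmod (\<Sum>\<theta>\<in>F. \<theta> x))\<^sup>2)
      = (cmod (\<Sum>\<theta>\<in>F. \<theta> 0))\<^sup>2 + (\<Sum>x\<in>K-{0}. (cmod (\<Sum>\<theta>\<in>F. \<theta> x))\<^sup>2)"
    using K add_subgroup_zero[OF K(1)] by (intro sum.remove)
  moreover have "(\<Sum>x\<in>K. (cmod (\<Sum>\<theta>\<in>F. \<theta> x))\<^sup>2) = real (card K) * real (card K)"
    using sum_norm_square_sum_chars[OF K(1) fin ch dist] by (simp add: full)
  ultimately have "(\<Sum>x\<in>K-{0}. (cmod (\<Sum>\<theta>\<in>F. \<theta> x))\<^sup>2) = 0"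
    by (simp add: s0 power2_eq_square)
  then have "\<forall>x\<in>K-{0}. (\<Sum>\<theta>\<in>F. \<theta> x) = 0"
    using K by (subst (asm) sum_nonneg_eq_0_iff) auto
  then show ?thesis using a s0 by auto
qed

section \<open>The dual of a finite subgroup\<close>

primrec nmul :: "nat \<Rightarrow> 'a::ab_group_add \<Rightarrow> 'a" where
  "nmul 0 x = 0"
| "nmul (Suc k) x = x + nmul k x"

lemma nmul_add: "nmul (k + l) x = nmul k x + nmul l x"
  by (induction k) (auto simp: add.assoc)

lemma nmul_mult: "nmul (k * l) x = nmul k (nmul l x)"
  by (induction k) (auto simp: nmul_add)

lemma nmul_closed: "add_subgroup H \<Longrightarrow> x \<in> H \<Longrightarrow> nmul k x \<in> H"
  by (induction k) (auto intro: add_subgroup_closed)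

lemma char_on_nmul: "add_subgroup H \<Longrightarrow> char_on H \<theta> \<Longrightarrow> x \<in> H \<Longrightarrow> \<theta> (nmul k x) = \<theta> x ^ k"
  by (induction k) (auto simp: char_on_zero char_on_add nmul_closed)

lemma nmul_eq_zero_ex:
  assumes "add_subgroup K" "finite K" "x \<in> K"
  shows "\<exists>n>0. nmul n x = 0"
proof -
  have "finite (range (\<lambda>k. nmul k x))"
    using assms nmul_closed by (metis finite_subset image_subsetI)
  then have "\<not> inj (\<lambda>k. nmul k x)"
    using finite_imageD infinite_UNIV_nat by blast
  then obtain i j where "i < j" "nmul i x = nmul j x"
    unfolding inj_def by (metis linorder_neqE_nat)
  moreover have "nmul j x = nmul i x + nmul (j - i) x"
    using \<open>i < j\<close> nmul_add[of i "j - i" x] by simp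
  ultimately show ?thesis by (intro exI[of _ "j - i"]) auto
qed

text \<open>
  A character extends from \<open>H\<close> to the group generated by \<open>H\<close> and \<open>x\<close> by any choice of its value \<open>z\<close> at \<open>x\<close>
  that is compatible with the least multiple \<open>nmul n x\<close> lying in \<open>H\<close>.  The freedom in \<open>z\<close> matters: it
  produces a nontrivial value in \<open>char_nontrivial_at\<close>.
\<close>

lemma char_extend_step:
  assumes K: "add_subgroup K" "finite K" and H: "add_subgroup H" "H \<subseteq> K"
    and \<theta>: "char_on H \<theta>" and x: "x \<in> K"
    and n: "n > 0" "nmul n x \<in> H" "\<And>k. 0 < k \<Longrightarrow> k < n \<Longrightarrow> nmul k x \<notin> H"
    and z: "z ^ n = \<theta> (nmul n x)"
  shows "\<exists>H' \<theta>'. add_subgroup H' \<and> H \<subseteq> H' \<and> H' \<subseteq> K \<and> x \<in> H' \<and> char_on H' \<theta>' \<and>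
           (\<forall>h\<in>H. \<theta>' h = \<theta> h) \<and> \<theta>' x = z"
proof -
  have zn: "cmod z = 1"
  proof -
    have "cmod z ^ n = 1" using z char_on_norm[OF \<theta> n(2)] by (simp flip: norm_power)
    then show ?thesis using n(1) power_eq_imp_eq_base[of "cmod z" n 1] by simp
  qed
  define H' where "H' = {h + nmul k x | h k. h \<in> H}"
  \<comment> \<open>A point may be written as \<open>h + nmul k x\<close> in several ways; \<open>p\<close> picks one, and \<open>wd\<close> shows that the choice is immaterial.\<close>
  define p where "p u = (SOME p. fst p \<in> H \<and> u = fst p + nmul (snd p) x)" for u
  define \<theta>' where "\<theta>' u = \<theta> (fst (p u)) * z ^ snd (p u)" for u
  have wd: "\<theta> h * z ^ k = \<theta> h' * z ^ k'"
    if "h \<in> H" "h' \<in> H" "h + nmul k x = h' + nmul k' x" "k \<le> k'" for h h' k k'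
  proof -
    define d where "d = k' - k"
    have hd: "h = h' + nmul d x" 
      using that nmul_add[of k d x] by (simp add: d_def algebra_simps)
    then have dH: "nmul d x \<in> H"
      using that H add_subgroup_diff by (metis add_diff_cancel_left')
    have "nmul (d mod n) x = nmul d x - nmul (d div n) (nmul n x)"
      using nmul_add[of "d div n * n" "d mod n" x]
      unfolding nmul_mult div_mult_mod_eq by (rule eq_diff_eq[THEN iffD2, OF trans[OF add.commute sym]])
    then have "nmul (d mod n) x \<in> H"
      using dH nmul_closed[OF H(1) n(2)] H by (auto intro: add_subgroup_closed)
    \<comment> \<open>Minimality of \<open>n\<close>.\<close>
    then have "d mod n = 0" using n(3)[of "d mod n"] n(1) by force
    then have dq: "d = d div n * n" by auto
    have "\<theta> (nmul d x) = \<theta> (nmul (d div n) (nmul n x))"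
      by (subst dq) (rule arg_cong[OF nmul_mult])
    also have "\<dots> = (z ^ n) ^ (d div n)"
      unfolding z by (rule char_on_nmul[OF H(1) \<theta> n(2)])
    also have "\<dots> = z ^ d"
      by (subst (2) dq) (simp only: power_mult[symmetric] mult.commute)
    finally have "\<theta> (nmul d x) = z ^ d" .
    then have "\<theta> h = \<theta> h' * z ^ d" using hd char_on_add[OF \<theta> that(2) dH] by simp
    then show ?thesis using that(4) by (simp add: d_def flip: power_add)
  qed
  have \<theta>'_eq: "\<theta>' (h + nmul k x) = \<theta> h * z ^ k" if "h \<in> H" for h k
  proof -
    have "fst (p (h + nmul k x)) \<in> H \<and>
        h + nmul k x = fst (p (h + nmul k x)) + nmul (snd (p (h + nmul k x))) x"
      unfolding p_def by (rule someI[of _ "(h, k)"]) (use that in auto)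
    then show ?thesis
      unfolding \<theta>'_def using wd that by (metis nle_le)
  qed
  have mem: "h + nmul k x \<in> H'" if "h \<in> H" for h k
    unfolding H'_def using that by blast
  have sub: "H \<subseteq> H'" using mem[of _ 0] by auto
  obtain N where N: "N > 0" "nmul N x = 0" using nmul_eq_zero_ex[OF K x] by auto
  have "add_subgroup H'"
    unfolding add_subgroup_def
  proof (intro conjI ballI)
    show "0 \<in> H'" using sub H add_subgroup_zero by auto
    fix u v assume "u \<in> H'" "v \<in> H'"
    then obtain h k h' k' where uv: "u = h + nmul k x" "v = h' + nmul k' x" "h \<in> H" "h' \<in> H"
      unfolding H'_def by auto
    have "nmul (k' * (N - 1)) x + nmul k' x = nmul (k' * N) x"
      using N(1) by (simp flip: nmul_add add: algebra_simps)
    also have "\<dots> = nmul k' 0" using N(2) by (simp add: nmul_mult)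
    also have "\<dots> = 0" by (induction k') auto
    finally have "- nmul k' x = nmul (k' * (N - 1)) x"
      by (metis add_eq_0_iff2 add.inverse_inverse)
    moreover have "u - v = (h - h') + (nmul k x + - nmul k' x)"
      using uv by (simp add: algebra_simps)
    ultimately have "u - v = (h - h') + nmul (k + k' * (N - 1)) x"
      by (simp only: nmul_add)
    then show "u - v \<in> H'"
      unfolding H'_def using uv H add_subgroup_diff by blast
  qed
  moreover have "H' \<subseteq> K"
    unfolding H'_def using H nmul_closed[OF K(1) x] add_subgroup_add[OF K(1)] by auto
  moreover have "x \<in> H'"
    using mem[OF add_subgroup_zero[OF H(1)], of 1] by simp
  moreover have "char_on H' \<theta>'"
    unfolding char_on_def
  proof (intro conjI ballI)
    fix u assume "u \<in> H'"
    then show "cmod (\<theta>' u) = 1"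
      unfolding H'_def using \<theta>'_eq char_on_norm[OF \<theta>] zn by (auto simp: norm_mult norm_power)
    fix v assume "v \<in> H'"
    with \<open>u \<in> H'\<close> obtain h k h' k' where uv: "u = h + nmul k x" "v = h' + nmul k' x" "h \<in> H" "h' \<in> H"
      unfolding H'_def by auto
    then have "u + v = (h + h') + nmul (k + k') x" by (simp add: nmul_add algebra_simps)
    then have "\<theta>' (u + v) = \<theta> (h + h') * z ^ (k + k')"
      using \<theta>'_eq[OF add_subgroup_add[OF H(1) uv(3,4)]] by (simp only:)
    then show "\<theta>' (u + v) = \<theta>' u * \<theta>' v"
      using uv \<theta>'_eq char_on_add[OF \<theta>] by (simp add: power_add)
  qed
  moreover have "\<forall>h\<in>H. \<theta>' h = \<theta> h" using \<theta>'_eq[of _ 0] by simp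
  moreover have "\<theta>' x = z"
    using \<theta>'_eq[OF add_subgroup_zero[OF H(1)], of 1] char_on_zero[OF H(1) \<theta>] by simp
  ultimately show ?thesis using sub by blast
qed

lemma complex_root_ex: "n > 0 \<Longrightarrow> \<exists>z::complex. z ^ n = w"
  by (rule exI[of _ "rcis (root n (cmod w)) (Arg w / n)"])
     (simp add: Complex.DeMoivre2 rcis_cmod_Arg)

lemma least_multiple_in_subgroup:
  assumes K: "add_subgroup K" "finite K" and H: "add_subgroup H" and x: "x \<in> K"
  obtains n where "n > 0" "nmul n x \<in> H" "\<And>k. 0 < k \<Longrightarrow> k < n \<Longrightarrow> nmul k x \<notin> H"
proof -
  have "\<exists>n. n > 0 \<and> nmul n x \<in> H"
    using nmul_eq_zero_ex[OF K x] add_subgroup_zero[OF H] by metis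
  from LeastI_ex[OF this] not_less_Least show ?thesis
    by (intro that[of "LEAST n. n > 0 \<and> nmul n x \<in> H"]) blast+
qed

lemma char_extend:
  assumes K: "add_subgroup K" "finite K" and "add_subgroup H" "H \<subseteq> K" "char_on H \<theta>"
  shows "\<exists>\<theta>'. char_on K \<theta>' \<and> (\<forall>h\<in>H. \<theta>' h = \<theta> h)"
  using assms(3-)
proof (induction "card (K - H)" arbitrary: H \<theta> rule: less_induct)
  case less
  show ?case
  proof (cases "H = K")
    case False
    then obtain x where x: "x \<in> K" "x \<notin> H" using less by auto
    obtain n where n: "n > 0" "nmul n x \<in> H" "\<And>k. 0 < k \<Longrightarrow> k < n \<Longrightarrow> nmul k x \<notin> H"
      using least_multiple_in_subgroup[OF K less.prems(1) x(1)] by metis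
    obtain z where z: "z ^ n = \<theta> (nmul n x)" using complex_root_ex[OF n(1)] by blast
    obtain H' \<theta>' where H': "add_subgroup H'" "H \<subseteq> H'" "H' \<subseteq> K" "x \<in> H'" "char_on H' \<theta>'"
      "\<forall>h\<in>H. \<theta>' h = \<theta> h"
      using char_extend_step[OF K less.prems x(1) n z] by metis
    have "card (K - H') < card (K - H)"
      using K H' x by (intro psubset_card_mono) auto
    from less.hyps[OF this H'(1,3,5)] show ?thesis using H' by (metis subsetD)
  qed (use less in auto)
qed

text \<open>
  On the cyclic group generated by \<open>a\<close> a primitive root of unity is an admissible value at \<open>a\<close>.
\<close>

lemma char_nontrivial_at:
  assumes K: "add_subgroup K" "finite K" and a: "a \<in> K" "a \<noteq> 0"
  shows "\<exists>\<theta>. char_on K \<theta> \<and> \<theta> a \<noteq> 1"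
proof -
  have z: "add_subgroup {0::'a}" "{0} \<subseteq> K" "char_on {0::'a} (\<lambda>_. 1)"
    using add_subgroup_zero[OF K(1)] by (auto simp: add_subgroup_def char_on_def)
  obtain n where n: "n > 0" "nmul n a \<in> {0}" "\<And>k. 0 < k \<Longrightarrow> k < n \<Longrightarrow> nmul k a \<notin> {0}"
    using least_multiple_in_subgroup[OF K z(1) a(1)] by metis
  have "n \<noteq> 1" using n(2) a(2) by auto
  define w where "w = cis (2 * pi / n)"
  have w: "w ^ n = 1"
    using n(1) cis_2pi unfolding w_def Complex.DeMoivre by simp
  have "w \<noteq> 1"
    using inj_onD[OF bij_betw_imp_inj_on[OF Complex.bij_betw_roots_unity[OF n(1)]], of 1 0]
      n(1) \<open>n \<noteq> 1\<close> by (auto simp: w_def)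
  obtain H \<theta> where H: "add_subgroup H" "H \<subseteq> K" "a \<in> H" "char_on H \<theta>" "\<theta> a = w"
    using char_extend_step[OF K z a(1) n w] by metis
  with char_extend[OF K H(1,2,4)] \<open>w \<noteq> 1\<close> show ?thesis by metis
qed

text \<open>
  Characters of \<open>K\<close> are normalized to vanish off \<open>K\<close>, so that each is represented by exactly one function.
\<close>

definition finite_dual :: "'a::ab_group_add set \<Rightarrow> ('a \<Rightarrow> complex) set" where
  "finite_dual K = {\<theta>. char_on K \<theta> \<and> (\<forall>x. x \<notin> K \<longrightarrow> \<theta> x = 0)}"

lemma char_on_finite_dual: "\<theta> \<in> finite_dual K \<Longrightarrow> char_on K \<theta>"
  by (simp add: finite_dual_def)

lemma distinct_on_finite_dual: "distinct_on K (finite_dual K)"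
  unfolding distinct_on_def finite_dual_def by (auto intro!: ext)

lemma finite_finite_dual:
  assumes K: "add_subgroup K" "finite K"
  shows "finite (finite_dual K)"
proof (rule ccontr)
  assume "infinite (finite_dual K)"
  then obtain F where F: "finite F" "card F = Suc (card K)" "F \<subseteq> finite_dual K"
    using infinite_arbitrarily_large by blast
  have "char_on K \<theta>" if "\<theta> \<in> F" for \<theta>
    using that F(3) char_on_finite_dual by auto
  from card_chars_le[OF K F(1) this distinct_on_subset[OF distinct_on_finite_dual F(3)]]
  have "card F \<le> card K" .
  then show False using F by simp
qed

text \<open>
  Multiplication by a character that is nontrivial at \<open>a\<close> permutes the dual, so the sum vanishes at
  \<open>a \<noteq> 0\<close>; summing over all points then shows that the dual has as many elements as \<open>K\<close>.
\<close>

lemma sum_finite_dual: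
  assumes K: "add_subgroup K" "finite K" and a: "a \<in> K"
  shows "(\<Sum>\<theta>\<in>finite_dual K. \<theta> a) = (if a = 0 then of_nat (card K) else 0)"
proof -
  let ?D = "finite_dual K"
  have off: "(\<Sum>\<theta>\<in>?D. \<theta> b) = 0" if b: "b \<in> K" "b \<noteq> 0" for b
  proof -
    obtain \<eta>' where \<eta>': "char_on K \<eta>'" "\<eta>' b \<noteq> 1" using char_nontrivial_at[OF K b] by auto
    define \<eta> where "\<eta> x = (if x \<in> K then \<eta>' x else 0)" for x
    have \<eta>: "char_on K \<eta>" "\<eta> b \<noteq> 1"
      using \<eta>' b add_subgroup_add[OF K(1)] by (auto simp: \<eta>_def char_on_def)
    have *: "\<theta> x * cnj (\<eta> x) * \<eta> x = \<theta> x" "\<theta> x * \<eta> x * cnj (\<eta> x) = \<theta> x" if "\<theta> \<in> ?D" for \<theta> x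
    proof -
      have "\<theta> x * (\<eta> x * cnj (\<eta> x)) = \<theta> x"
        using char_on_cnj[OF \<eta>(1), of x] that
        by (cases "x \<in> K") (auto simp: finite_dual_def)
      then show "\<theta> x * cnj (\<eta> x) * \<eta> x = \<theta> x" "\<theta> x * \<eta> x * cnj (\<eta> x) = \<theta> x"
        by (simp_all only: mult_ac)
    qed
    have "(\<Sum>\<theta>\<in>?D. \<theta> b) = (\<Sum>\<theta>\<in>?D. \<theta> b * \<eta> b)"
      by (rule sum.reindex_bij_witness[where i = "\<lambda>\<theta> x. \<theta> x * \<eta> x" and j = "\<lambda>\<theta> x. \<theta> x * cnj (\<eta> x)"])
         (use * \<eta> in \<open>auto simp: finite_dual_def char_on_mult char_on_cnj_mult\<close>)
    then have "(\<Sum>\<theta>\<in>?D. \<theta> b) * (1 - \<eta> b) = 0"       unfolding right_diff_distrib sum_distrib_right[symmetric] by (simp only: mult_1_right diff_self)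
    with \<eta>(2) show ?thesis by simp
  qed
  have "(\<Sum>b\<in>K. \<Sum>\<theta>\<in>?D. \<theta> b) = (\<Sum>\<theta>\<in>?D. \<theta> 0) + (\<Sum>b\<in>K-{0}. \<Sum>\<theta>\<in>?D. \<theta> b)"
    using K add_subgroup_zero by (intro sum.remove) auto
  also have "(\<Sum>b\<in>K-{0}. \<Sum>\<theta>\<in>?D. \<theta> b) = 0" using off by (intro sum.neutral) auto
  finally have "(\<Sum>\<theta>\<in>?D. \<theta> 0) = (\<Sum>b\<in>K. \<Sum>\<theta>\<in>?D. \<theta> b)" by simp
  also have "\<dots> = (\<Sum>\<theta>\<in>?D. \<Sum>b\<in>K. \<theta> b)" by (rule sum.swap)
  also have "\<dots> = (\<Sum>\<theta>\<in>?D. if \<theta> = (\<lambda>x. if x \<in> K then 1 else 0) then of_nat (card K) else 0)"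
  proof (intro sum.cong refl)
    fix \<theta> assume "\<theta> \<in> ?D"
    then have "(\<forall>a\<in>K. \<theta> a = 1) \<longleftrightarrow> \<theta> = (\<lambda>x. if x \<in> K then 1 else 0)"
      by (auto simp: finite_dual_def fun_eq_iff)
    then show "(\<Sum>b\<in>K. \<theta> b) = (if \<theta> = (\<lambda>x. if x \<in> K then 1 else 0) then of_nat (card K) else 0)"
      using sum_char[OF K(1) char_on_finite_dual[OF \<open>\<theta> \<in> ?D\<close>]] by simp
  qed
  also have "\<dots> = of_nat (card K)"
  proof -
    have "(\<lambda>x. if x \<in> K then 1 else 0) \<in> ?D"
      using add_subgroup_add[OF K(1)] by (auto simp: finite_dual_def char_on_def)
    then show ?thesis using finite_finite_dual[OF K] by simp
  qed
  finally show ?thesis using off a by auto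
qed

section \<open>Plancherel's identity on finite subgroups\<close>

definition finite_coeff :: "'a set \<Rightarrow> ('a \<Rightarrow> complex) \<Rightarrow> ('a \<Rightarrow> complex) \<Rightarrow> complex" where
  "finite_coeff K f \<theta> = (\<Sum>b\<in>K. f b * cnj (\<theta> b))"

definition autocorrelation :: "'a::ab_group_add set \<Rightarrow> ('a \<Rightarrow> complex) \<Rightarrow> 'a \<Rightarrow> complex" where
  "autocorrelation K f y = (\<Sum>a\<in>K. f (a + y) * cnj (f a))"

lemma finite_plancherel:
  assumes K: "add_subgroup K" "finite K" and y: "y \<in> K"
  shows "(\<Sum>\<theta>\<in>finite_dual K. of_real ((cmod (finite_coeff K f \<theta>))\<^sup>2) * \<theta> y)
         = of_nat (card K) * autocorrelation K f y"
proof -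
  let ?D = "finite_dual K"
  have expand: "of_real ((cmod (finite_coeff K f \<theta>))\<^sup>2) * \<theta> y
      = (\<Sum>b\<in>K. \<Sum>a\<in>K. f a * cnj (f b) * \<theta> (b + y - a))" if "\<theta> \<in> ?D" for \<theta>
  proof -
    have ch: "char_on K \<theta>" using that by (rule char_on_finite_dual)
    have "of_real ((cmod (finite_coeff K f \<theta>))\<^sup>2) * \<theta> y
        = (\<Sum>a\<in>K. \<Sum>b\<in>K. (f a * cnj (\<theta> a)) * cnj (f b * cnj (\<theta> b))) * \<theta> y"
      unfolding complex_norm_square finite_coeff_def cnj_sum sum_product ..
    also have "\<dots> = (\<Sum>a\<in>K. \<Sum>b\<in>K. f a * cnj (f b) * \<theta> (b + y - a))"
      unfolding sum_distrib_right
    proof (intro sum.cong refl)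
      fix a b assume "a \<in> K" "b \<in> K"
      then have "\<theta> (b + y - a) = \<theta> b * \<theta> y * cnj (\<theta> a)"
        using char_on_diff[OF K(1) ch] char_on_add[OF ch] y add_subgroup_add[OF K(1)] by simp
      then show "f a * cnj (\<theta> a) * cnj (f b * cnj (\<theta> b)) * \<theta> y = f a * cnj (f b) * \<theta> (b + y - a)"
        by simp
    qed
    also have "\<dots> = (\<Sum>b\<in>K. \<Sum>a\<in>K. f a * cnj (f b) * \<theta> (b + y - a))" by (rule sum.swap)
    finally show ?thesis .
  qed
  have "(\<Sum>\<theta>\<in>?D. of_real ((cmod (finite_coeff K f \<theta>))\<^sup>2) * \<theta> y)
      = (\<Sum>\<theta>\<in>?D. \<Sum>b\<in>K. \<Sum>a\<in>K. f a * cnj (f b) * \<theta> (b + y - a))"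
    by (rule sum.cong[OF refl expand])
  also have "\<dots> = (\<Sum>b\<in>K. \<Sum>\<theta>\<in>?D. \<Sum>a\<in>K. f a * cnj (f b) * \<theta> (b + y - a))"
    by (rule sum.swap)
  also have "\<dots> = (\<Sum>b\<in>K. \<Sum>a\<in>K. \<Sum>\<theta>\<in>?D. f a * cnj (f b) * \<theta> (b + y - a))"
    by (intro sum.cong refl, rule sum.swap)
  also have "\<dots> = (\<Sum>b\<in>K. \<Sum>a\<in>K. if b + y = a then of_nat (card K) * (f a * cnj (f b)) else 0)"
  proof (intro sum.cong refl)
    fix a b assume "a \<in> K" "b \<in> K"
    then have "b + y - a \<in> K" using y K(1) by (auto intro: add_subgroup_closed)
    then show "(\<Sum>\<theta>\<in>?D. f a * cnj (f b) * \<theta> (b + y - a))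
        = (if b + y = a then of_nat (card K) * (f a * cnj (f b)) else 0)"
      using sum_finite_dual[OF K, of "b + y - a"] by (simp flip: sum_distrib_left)
  qed
  also have "\<dots> = of_nat (card K) * autocorrelation K f y"
    unfolding autocorrelation_def sum_distrib_left
    using y K by (intro sum.cong refl) (auto simp: add_subgroup_add)
  finally show ?thesis .
qed

lemma finite_coeff_autocorrelation:
  assumes K: "add_subgroup K" and \<theta>: "char_on K \<theta>"
  shows "finite_coeff K (autocorrelation K f) \<theta> = of_real ((cmod (finite_coeff K f \<theta>))\<^sup>2)"
proof -
  have "finite_coeff K (autocorrelation K f) \<theta>
      = (\<Sum>a\<in>K. \<Sum>y\<in>K. f (a + y) * cnj (f a) * cnj (\<theta> y))"
    unfolding finite_coeff_def autocorrelation_def sum_distrib_right by (rule sum.swap)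
  also have "\<dots> = (\<Sum>a\<in>K. (\<Sum>y\<in>K. f (y + a) * cnj (\<theta> (y + a))) * cnj (f a * cnj (\<theta> a)))"
    unfolding sum_distrib_right
  proof (intro sum.cong refl)
    fix a y assume "a \<in> K" "y \<in> K"
    then have "cnj (\<theta> (y + a)) * \<theta> a = cnj (\<theta> y)"
      using char_on_add[OF \<theta>] char_on_cnj[OF \<theta> \<open>a \<in> K\<close>] by (simp add: mult.assoc mult.commute)
    then have "cnj (\<theta> y) = cnj (\<theta> (y + a)) * \<theta> a" by simp
    then show "f (a + y) * cnj (f a) * cnj (\<theta> y)
        = f (y + a) * cnj (\<theta> (y + a)) * cnj (f a * cnj (\<theta> a))"
      by (simp add: add.commute)
  qed
  also have "\<dots> = (\<Sum>a\<in>K. finite_coeff K f \<theta> * cnj (f a * cnj (\<theta> a)))"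
    using sum_subgroup_shift[OF K, of _ "\<lambda>x. f x * cnj (\<theta> x)"]
    by (intro sum.cong refl) (simp add: finite_coeff_def)
  also have "\<dots> = finite_coeff K f \<theta> * cnj (finite_coeff K f \<theta>)"
    by (simp only: finite_coeff_def cnj_sum sum_distrib_left)
  finally show ?thesis by (simp only: complex_norm_square)
qed

text \<open>
  Let \<open>q \<theta>\<close> be the squared modulus of the coefficient of \<open>f\<close>.  It is also the coefficient of the
  autocorrelation \<open>h\<close>, so Plancherel for \<open>f\<close> bounds the sum of \<open>q\<close> above, and Plancherel for \<open>h\<close> bounds the
  sum of \<open>(q \<theta>)\<^sup>2 * (1 - Re (\<theta> y))\<close> below.  By averaging, some \<open>q \<theta> * (1 - Re (\<theta> y))\<close> is large, and as
  both factors are bounded, both are large.  All bounds scale correctly with the order of \<open>K\<close>.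
\<close>

lemma ex_char_large_coeff:
  fixes f :: "'a::ab_group_add \<Rightarrow> real"
  assumes K: "add_subgroup K" "finite K" and y: "y \<in> K" and f: "\<And>b. b \<in> K \<Longrightarrow> \<bar>f b\<bar> \<le> 1"
  defines "h \<equiv> \<lambda>y. \<Sum>a\<in>K. f (a + y) * f a"
  assumes zero: "(\<Sum>a\<in>K. h (a + y) * h a) = 0"
    and big: "c * real (card K) ^ 3 \<le> (\<Sum>a\<in>K. (h a)\<^sup>2)" and c: "c > 0"
  shows "\<exists>\<theta>. char_on K \<theta> \<and> c / 4 * (real (card K))\<^sup>2 \<le> (cmod (finite_coeff K (\<lambda>x. of_real (f x)) \<theta>))\<^sup>2
             \<and> c / 2 \<le> 1 - Re (\<theta> y)"
proof -
  let ?D = "finite_dual K"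
  define n where "n = real (card K)"
  have n: "n > 0" using K add_subgroup_zero[OF K(1)] by (auto simp: n_def card_gt_0_iff)
  define F where "F = (\<lambda>x. complex_of_real (f x))"
  define q where "q \<theta> = (cmod (finite_coeff K F \<theta>))\<^sup>2" for \<theta>
  have ac: "autocorrelation K F = (\<lambda>x. of_real (h x))"
    by (simp add: fun_eq_iff autocorrelation_def F_def h_def)
  have ac2: "autocorrelation K (autocorrelation K F) x = of_real (\<Sum>a\<in>K. h (a + x) * h a)" for x
    unfolding ac by (simp add: autocorrelation_def)
  have P: "(\<Sum>\<theta>\<in>?D. q \<theta> * Re (\<theta> x)) = n * h x" if "x \<in> K" for x
    using finite_plancherel[OF K that, of F, THEN arg_cong[of _ _ Re]]
    unfolding ac by (simp add: q_def n_def)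
  have P2: "(\<Sum>\<theta>\<in>?D. (q \<theta>)\<^sup>2 * Re (\<theta> x)) = n * (\<Sum>a\<in>K. h (a + x) * h a)" if "x \<in> K" for x
  proof -
    have "(\<Sum>\<theta>\<in>?D. (q \<theta>)\<^sup>2 * Re (\<theta> x))
        = (\<Sum>\<theta>\<in>?D. Re (of_real ((cmod (finite_coeff K (autocorrelation K F) \<theta>))\<^sup>2) * \<theta> x))"
      by (intro sum.cong refl)
         (simp add: finite_coeff_autocorrelation[OF K(1) char_on_finite_dual] q_def norm_power)
    also have "\<dots> = n * (\<Sum>a\<in>K. h (a + x) * h a)"
      using finite_plancherel[OF K that, of "autocorrelation K F", THEN arg_cong[of _ _ Re]]
      unfolding ac2 by (simp add: n_def)
    finally show ?thesis .
  qed
  have one: "\<theta> 0 = 1" if "\<theta> \<in> ?D" for \<theta>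
    using char_on_zero[OF K(1) char_on_finite_dual[OF that]] .
  have K0: "0 \<in> K" using add_subgroup_zero[OF K(1)] .
  have sum_q: "(\<Sum>\<theta>\<in>?D. q \<theta>) \<le> n\<^sup>2"
  proof -
    have "(\<Sum>\<theta>\<in>?D. q \<theta>) = (\<Sum>\<theta>\<in>?D. q \<theta> * Re (\<theta> 0))"
      by (intro sum.cong) (auto simp: one)
    also have "\<dots> = n * (\<Sum>a\<in>K. f a * f a)" using P[OF K0] by (simp add: h_def)
    also have "\<dots> \<le> n * (\<Sum>a\<in>K. 1)"
      using f n by (intro mult_left_mono sum_mono) (auto simp: abs_le_square_iff[of _ 1, simplified] power2_eq_square)
    finally show ?thesis by (simp add: n_def power2_eq_square)
  qed
  have "(\<Sum>\<theta>\<in>?D. (q \<theta>)\<^sup>2) = (\<Sum>\<theta>\<in>?D. (q \<theta>)\<^sup>2 * Re (\<theta> 0))"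
    by (intro sum.cong) (auto simp: one)
  also have "\<dots> = n * (\<Sum>a\<in>K. (h a)\<^sup>2)" using P2[OF K0] by (simp add: power2_eq_square)
  finally have "n * (c * n ^ 3) \<le> (\<Sum>\<theta>\<in>?D. (q \<theta>)\<^sup>2)"
    using big n by (simp add: n_def)
  then have total: "c * n ^ 4 \<le> (\<Sum>\<theta>\<in>?D. q \<theta> * (q \<theta> * (1 - Re (\<theta> y))))"
    using P2[OF y] zero
    by (simp add: algebra_simps sum_subtractf power2_eq_square power3_eq_cube power4_eq_xxxx)
  have "\<exists>\<theta>\<in>?D. c / 2 * n\<^sup>2 \<le> q \<theta> * (1 - Re (\<theta> y))"
  proof (rule ccontr)
    assume "\<not> ?thesis"
    then have "(\<Sum>\<theta>\<in>?D. q \<theta> * (q \<theta> * (1 - Re (\<theta> y)))) \<le> (\<Sum>\<theta>\<in>?D. q \<theta> * (c / 2 * n\<^sup>2))"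
      by (intro sum_mono mult_left_mono) (auto simp: not_le q_def intro: less_imp_le)
    also have "\<dots> = (\<Sum>\<theta>\<in>?D. q \<theta>) * (c / 2 * n\<^sup>2)" by (simp only: sum_distrib_right)
    also have "\<dots> \<le> n\<^sup>2 * (c / 2 * n\<^sup>2)" using sum_q c by (intro mult_right_mono) auto
    also have "\<dots> = c / 2 * n ^ 4" by (simp add: power2_eq_square power4_eq_xxxx)
    also have "\<dots> < c * n ^ 4" using c n by simp
    finally show False using total by simp
  qed
  then obtain \<theta> where \<theta>: "\<theta> \<in> ?D" "c / 2 * n\<^sup>2 \<le> q \<theta> * (1 - Re (\<theta> y))" by auto
  have ch: "char_on K \<theta>" using \<theta>(1) by (rule char_on_finite_dual)
  have "q \<theta> \<ge> 0" by (simp add: q_def)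
  have "\<bar>Re (\<theta> y)\<bar> \<le> 1" using abs_Re_le_cmod[of "\<theta> y"] char_on_norm[OF ch y] by simp
  then have "q \<theta> * (1 - Re (\<theta> y)) \<le> q \<theta> * 2"
    using \<open>q \<theta> \<ge> 0\<close> by (intro mult_left_mono) auto
  then have 1: "c / 4 * n\<^sup>2 \<le> q \<theta>" using \<theta>(2) by simp
  have "cmod (finite_coeff K F \<theta>) \<le> (\<Sum>b\<in>K. 1)"
    unfolding finite_coeff_def
    by (rule sum_norm_le) (use f char_on_norm[OF ch] in \<open>auto simp: norm_mult F_def\<close>)
  then have "q \<theta> \<le> n\<^sup>2"
    unfolding q_def by (intro power_mono) (auto simp: n_def)
  then have "q \<theta> * (1 - Re (\<theta> y)) \<le> n\<^sup>2 * (1 - Re (\<theta> y))"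
    using \<open>\<bar>Re (\<theta> y)\<bar> \<le> 1\<close> by (intro mult_right_mono) auto
  then have "n\<^sup>2 * (c / 2) \<le> n\<^sup>2 * (1 - Re (\<theta> y))"
    using \<theta>(2) by (simp only: mult.commute[of "n\<^sup>2" "c / 2"])
  then have "c / 2 \<le> 1 - Re (\<theta> y)" by (rule mult_left_le_imp_le) (use n in simp)
  then show ?thesis using 1 ch unfolding q_def n_def F_def by blast
qed

text \<open>
  Translating \<open>f\<close> by \<open>a\<close> multiplies its coefficient by \<open>\<theta> a\<close>, so a large coefficient of a function with
  small oscillation forces \<open>\<theta>\<close> to be close to \<open>1\<close>.  This is the source of equicontinuity.
\<close>

lemma char_near_one:
  assumes K: "add_subgroup K" and \<theta>: "char_on K \<theta>" and a: "a \<in> K"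
    and close: "\<And>b. b \<in> K \<Longrightarrow> cmod (f (b + a) - f b) \<le> \<epsilon>"
  shows "cmod (\<theta> a - 1) * cmod (finite_coeff K f \<theta>) \<le> \<epsilon> * real (card K)"
proof -
  have "\<theta> a * finite_coeff K f \<theta> = (\<Sum>b\<in>K. \<theta> a * (f (b + a) * cnj (\<theta> (b + a))))"
    unfolding finite_coeff_def sum_distrib_left[symmetric]
    using sum_subgroup_shift[OF K a, of "\<lambda>x. f x * cnj (\<theta> x)"] by simp
  also have "\<dots> = (\<Sum>b\<in>K. f (b + a) * cnj (\<theta> b))"
  proof (intro sum.cong refl)
    fix b assume "b \<in> K"
    then have "\<theta> a * cnj (\<theta> (b + a)) = (\<theta> a * cnj (\<theta> a)) * cnj (\<theta> b)"
      by (simp add: char_on_add[OF \<theta> _ a])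
    also have "\<dots> = cnj (\<theta> b)" by (simp add: char_on_cnj[OF \<theta> a])
    finally show "\<theta> a * (f (b + a) * cnj (\<theta> (b + a))) = f (b + a) * cnj (\<theta> b)"
      by (metis mult.left_commute)
  qed
  finally have "(\<theta> a - 1) * finite_coeff K f \<theta> = (\<Sum>b\<in>K. (f (b + a) - f b) * cnj (\<theta> b))"
    unfolding left_diff_distrib sum_subtractf by (simp add: finite_coeff_def)
  then have "cmod (\<theta> a - 1) * cmod (finite_coeff K f \<theta>) = cmod (\<Sum>b\<in>K. (f (b + a) - f b) * cnj (\<theta> b))"
    by (metis norm_mult)
  also have "\<dots> \<le> (\<Sum>b\<in>K. \<epsilon>)"
    by (rule sum_norm_le) (use close char_on_norm[OF \<theta>] in \<open>auto simp: norm_mult\<close>)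
  finally show ?thesis by (simp add: mult.commute)
qed

section \<open>Characters of the compact group separate points\<close>

lemma nhd_zero_diff:
  fixes W :: "'a::topological_ab_group_add set"
  assumes "open W" "0 \<in> W"
  obtains U where "open U" "0 \<in> U" "\<And>u v. u \<in> U \<Longrightarrow> v \<in> U \<Longrightarrow> u - v \<in> W"
proof -
  have "continuous_on UNIV (\<lambda>p::'a \<times> 'a. fst p - snd p)"
    unfolding continuous_on_def by (intro ballI tendsto_intros)
  then have "open ((\<lambda>p::'a \<times> 'a. fst p - snd p) -` W)"
    using assms(1) by (rule open_vimage[rotated])
  moreover have "(0, 0) \<in> (\<lambda>p. fst p - snd p) -` W" using assms(2) by simp
  ultimately obtain U V where "open U" "open V" "(0, 0) \<in> U \<times> V" "U \<times> V \<subseteq> (\<lambda>p. fst p - snd p) -` W"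
    by (rule open_prod_elim)
  then show thesis by (intro that[of "U \<inter> V"]) auto
qed

lemma open_translate_vimage:
  fixes U :: "'a::topological_ab_group_add set"
  assumes "open U" shows "open {x. x - a \<in> U}"
proof -
  have "continuous_on UNIV (\<lambda>x. x - a)" by (intro continuous_on_diff continuous_on_id continuous_on_const)
  then show ?thesis using open_vimage[OF assms, of "\<lambda>x. x - a"] by (simp add: vimage_def)
qed

lemma uniform_continuity_translation:
  fixes f :: "'a::topological_ab_group_add \<Rightarrow> real"
  assumes "compact (UNIV :: 'a set)" "continuous_on UNIV f" "e > 0"
  obtains U where "open U" "0 \<in> U" "\<And>u b. u \<in> U \<Longrightarrow> \<bar>f (b + u) - f b\<bar> < e"
proof -
  let ?g = "\<lambda>p::'a \<times> 'a. \<bar>f (snd p + fst p) - f (snd p)\<bar>"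
  have add: "continuous_on UNIV (\<lambda>p::'a \<times> 'a. snd p + fst p)"
    unfolding continuous_on_def by (intro ballI tendsto_intros)
  have "continuous_on UNIV ?g"
    by (intro continuous_intros continuous_on_compose2[OF assms(2)] add) auto
  then have "open (?g -` {..<e})" by (intro open_vimage) auto
  moreover have "{0} \<times> UNIV \<subseteq> ?g -` {..<e}" using assms(3) by auto
  ultimately obtain U where "0 \<in> U" "open U" "U \<times> UNIV \<subseteq> ?g -` {..<e}"
    using Elementary_Topology.tube_lemma[OF assms(1), of "?g -` {..<e}" 0] by blast
  then show thesis using that[of U] by fastforce
qed

text \<open>
  The uniform substitute for the statement that an open set has positive Haar measure.  Finitely
  many translates of a smaller neighbourhood cover the group; one of them contains a proportional
  share of \<open>K\<close>, and differences of its points lie in \<open>V\<close>.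
\<close>

lemma finite_subgroup_meets_nhd:
  fixes V :: "'a::topological_ab_group_add set"
  assumes cpt: "compact (UNIV :: 'a set)" and V: "open V" "0 \<in> V"
  obtains N :: nat where "N > 0"
    "\<And>K. add_subgroup K \<Longrightarrow> finite K \<Longrightarrow> card K \<le> N * card (K \<inter> V)"
proof -
  obtain U where U: "open U" "0 \<in> U" "\<And>u v. u \<in> U \<Longrightarrow> v \<in> U \<Longrightarrow> u - v \<in> V"
    using nhd_zero_diff[OF V] by metis
  have "UNIV \<subseteq> (\<Union>g\<in>UNIV. {x. x - g \<in> U})"
  proof
    fix x :: 'a
    show "x \<in> (\<Union>g\<in>UNIV. {x. x - g \<in> U})" using U(2) by (auto intro!: exI[of _ x])
  qed
  from compactE_image[OF cpt open_translate_vimage[OF U(1)] this]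
  obtain S where S: "finite S" "UNIV \<subseteq> (\<Union>g\<in>S. {x. x - g \<in> U})"
    by metis
  have "S \<noteq> {}" using S by auto
  show thesis
  proof (rule that[of "card S"])
    show "card S > 0" using S \<open>S \<noteq> {}\<close> by (simp add: card_gt_0_iff)
    fix K :: "'a set" assume K: "add_subgroup K" "finite K"
    have one: "card (K \<inter> {x. x - g \<in> U}) \<le> card (K \<inter> V)" for g
    proof (cases "K \<inter> {x. x - g \<in> U} = {}")
      case False
      then obtain k where k: "k \<in> K" "k - g \<in> U" by auto
      show ?thesis
      proof (rule card_inj_on_le)
        show "inj_on (\<lambda>x. x - k) (K \<inter> {x. x - g \<in> U})" by (auto simp: inj_on_def)
        show "(\<lambda>x. x - k) ` (K \<inter> {x. x - g \<in> U}) \<subseteq> K \<inter> V"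
        proof
          fix y assume "y \<in> (\<lambda>x. x - k) ` (K \<inter> {x. x - g \<in> U})"
          then obtain x where "y = x - k" "x \<in> K" "x - g \<in> U" by auto
          then show "y \<in> K \<inter> V"
            using U(3)[of "x - g" "k - g"] k add_subgroup_diff[OF K(1)] by simp
        qed
      qed (use K in auto)
    qed auto
    have "K = (\<Union>g\<in>S. K \<inter> {x. x - g \<in> U})" using S(2) by auto
    then have "card K \<le> (\<Sum>g\<in>S. card (K \<inter> {x. x - g \<in> U}))"
      using card_UN_le[OF S(1)] by metis
    also have "\<dots> \<le> (\<Sum>g\<in>S. card (K \<inter> V))" by (rule sum_mono[OF one])
    finally show "card K \<le> card S * card (K \<inter> V)" by simp
  qed
qed

lemma urysohn_compact:
  fixes S T :: "'a::t2_space set"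
  assumes "compact (UNIV :: 'a set)" "closed S" "closed T" "S \<inter> T = {}"
  obtains f :: "'a \<Rightarrow> real" where "continuous_on UNIV f" "\<And>x. 0 \<le> f x" "\<And>x. f x \<le> 1"
    "\<And>x. x \<in> S \<Longrightarrow> f x = 0" "\<And>x. x \<in> T \<Longrightarrow> f x = 1"
proof -
  have "Hausdorff_space (euclidean :: 'a topology)"
    unfolding Hausdorff_space_def by (auto simp: disjnt_def) (metis hausdorff)
  then have "normal_space (euclidean :: 'a topology)"
    using assms(1) by (intro compact_Hausdorff_or_regular_imp_normal_space) (auto simp: compact_space_def)
  then obtain f where f: "continuous_map (euclidean :: 'a topology) (top_of_set {0..1::real}) f"
    "f ` S \<subseteq> {0}" "f ` T \<subseteq> {1}"
    by (rule Urysohn_lemma[of _ S T 0 1]) (use assms in \<open>auto simp: disjnt_def\<close>)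
  then have "continuous_on UNIV f" "f \<in> UNIV \<rightarrow> {0..1}"
    by (auto simp: continuous_map_in_subtopology)
  then show thesis using f(2,3) by (intro that[of f]) (auto simp: Pi_iff)
qed

text \<open>
  The function is a bump supported in a neighbourhood so small that no point near \<open>x0\<close> is a
  difference of two differences of support points; this makes the correlation sum vanish.  Since
  every finite subgroup has a proportional share near \<open>0\<close>, the constant \<open>c\<close> serves all of them at once.
\<close>

lemma ex_bump:
  fixes x0 :: "'a::{topological_ab_group_add, t2_space}"
  assumes cpt: "compact (UNIV :: 'a set)" and x0: "x0 \<noteq> 0"
  shows "\<exists>(f :: 'a \<Rightarrow> real) c W.
    continuous_on UNIV f \<and> (\<forall>x. \<bar>f x\<bar> \<le> 1) \<and> c > 0 \<and> open W \<and> 0 \<in> W \<and>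
    (\<forall>K y. add_subgroup K \<longrightarrow> finite K \<longrightarrow> y \<in> K \<longrightarrow> y - x0 \<in> W \<longrightarrow>
       (\<Sum>a\<in>K. (\<Sum>b\<in>K. f (b + (a + y)) * f b) * (\<Sum>b\<in>K. f (b + a) * f b)) = 0) \<and>
    (\<forall>K. add_subgroup K \<longrightarrow> finite K \<longrightarrow>
       c * real (card K) ^ 3 \<le> (\<Sum>a\<in>K. (\<Sum>b\<in>K. f (b + a) * f b)\<^sup>2))"
proof -
  \<comment> \<open>\<open>W2\<close> receives the differences of support points, \<open>W1\<close> the differences of those, and \<open>- {x0}\<close> one difference more.\<close>
  have "open (- {x0})" "0 \<in> - {x0}" using x0 by auto
  then obtain W1 where W1: "open W1" "0 \<in> W1" "\<And>u v. u \<in> W1 \<Longrightarrow> v \<in> W1 \<Longrightarrow> u - v \<in> - {x0}"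
    using nhd_zero_diff by metis
  obtain W2 where W2: "open W2" "0 \<in> W2" "\<And>u v. u \<in> W2 \<Longrightarrow> v \<in> W2 \<Longrightarrow> u - v \<in> W1"
    using nhd_zero_diff[OF W1(1,2)] by metis
  obtain U where U: "open U" "0 \<in> U" "\<And>u v. u \<in> U \<Longrightarrow> v \<in> U \<Longrightarrow> u - v \<in> W2"
    using nhd_zero_diff[OF W2(1,2)] by metis
  obtain f :: "'a \<Rightarrow> real" where f: "continuous_on UNIV f" "\<And>x. 0 \<le> f x" "\<And>x. f x \<le> 1"
    "\<And>x. x \<in> - U \<Longrightarrow> f x = 0" "\<And>x. x \<in> {0} \<Longrightarrow> f x = 1"
    using urysohn_compact[OF cpt, of "- U" "{0}"] U by auto
  have "open (f -` {1/2<..})" by (intro open_vimage f) auto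
  moreover have "0 \<in> f -` {1/2<..}" using f(5) by simp
  ultimately obtain V where V: "open V" "0 \<in> V" "\<And>u v. u \<in> V \<Longrightarrow> v \<in> V \<Longrightarrow> u - v \<in> f -` {1/2<..}"
    using nhd_zero_diff by metis
  obtain N :: nat where N: "N > 0"
    "\<And>K. add_subgroup K \<Longrightarrow> finite K \<Longrightarrow> card K \<le> N * card (K \<inter> V)"
    using finite_subgroup_meets_nhd[OF cpt V(1,2)] by metis
  show ?thesis
  proof (intro exI[of _ f] exI[of _ "1 / (16 * real N ^ 3)"] exI[of _ W1] conjI allI impI)
    show "\<bar>f x\<bar> \<le> 1" for x using f(2,3) by simp
    show "1 / (16 * real N ^ 3) > 0" using N(1) by simp
  next
    fix K y assume K: "add_subgroup K" "finite (K :: 'a set)" and y: "y \<in> K" "y - x0 \<in> W1"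
    have diff: "a \<in> W2" if nz: "(\<Sum>b\<in>K. f (b + a) * f b) \<noteq> 0" for a
    proof -
      obtain b where "f (b + a) * f b \<noteq> 0" using nz by (meson sum.neutral)
      then have "b + a \<in> U" "b \<in> U" using f(4)[of "b + a"] f(4)[of b] by auto
      then show ?thesis using U(3)[of "b + a" b] by simp
    qed
    show "(\<Sum>a\<in>K. (\<Sum>b\<in>K. f (b + (a + y)) * f b) * (\<Sum>b\<in>K. f (b + a) * f b)) = 0"
    proof (rule sum.neutral, intro ballI, rule ccontr)
      fix a assume "(\<Sum>b\<in>K. f (b + (a + y)) * f b) * (\<Sum>b\<in>K. f (b + a) * f b) \<noteq> 0"
      then have "a + y \<in> W2" "a \<in> W2" using diff[of "a + y"] diff[of a] by auto
      then have "y \<in> W1" using W2(3)[of "a + y" a] by simp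
      then have "y - (y - x0) \<in> - {x0}" using W1(3)[OF _ y(2)] by blast
      then show False by simp
    qed
  next
    fix K :: "'a set" assume K: "add_subgroup K" "finite K"
    let ?h = "\<lambda>a. \<Sum>b\<in>K. f (b + a) * f b"
    let ?p = "real (card (K \<inter> V))"
    \<comment> \<open>A share of at least \<open>1 / N\<close> of the points lies in \<open>V\<close>, and the correlation at the negatives of these is at least a quarter of their number; the cube in \<open>c\<close> comes from one factor for the points and two for the square.\<close>
    have h: "?p / 4 \<le> ?h (- u)" if "u \<in> K \<inter> V" for u
    proof -
      have "?p / 4 = (\<Sum>b\<in>K \<inter> V. 1 / 2 * (1 / 2))" by simp
      also have "\<dots> \<le> (\<Sum>b\<in>K \<inter> V. f (b + - u) * f b)"
      proof (intro sum_mono mult_mono)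
        fix b assume b: "b \<in> K \<inter> V"
        show "1 / 2 \<le> f (b + - u)" using V(3)[of b u] b that by simp
        show "1 / 2 \<le> f b" using V(3)[of b 0] b V(2) by simp
      qed (use f in auto)
      also have "\<dots> \<le> ?h (- u)" using K f by (intro sum_mono2) auto
      finally show ?thesis .
    qed
    have "?p * (?p / 4)\<^sup>2 = (\<Sum>u\<in>K \<inter> V. (?p / 4)\<^sup>2)" by simp
    also have "\<dots> \<le> (\<Sum>u\<in>K \<inter> V. (?h (- u))\<^sup>2)"
      using h by (intro sum_mono power_mono) auto
    also have "\<dots> \<le> (\<Sum>u\<in>K. (?h (- u))\<^sup>2)" using K by (intro sum_mono2) auto
    also have "\<dots> = (\<Sum>a\<in>K. (?h a)\<^sup>2)"
      by (rule sum.reindex_bij_witness[where i = uminus and j = uminus])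
         (use add_subgroup_uminus[OF K(1)] in auto)
    finally have lower: "?p * (?p / 4)\<^sup>2 \<le> (\<Sum>a\<in>K. (?h a)\<^sup>2)" .
    have "real (card K) \<le> real N * ?p" using N(2)[OF K] by (metis of_nat_le_iff of_nat_mult)
    then have "real (card K) ^ 3 \<le> (real N * ?p) ^ 3" by (intro power_mono) auto
    then have "1 / (16 * real N ^ 3) * real (card K) ^ 3 \<le> ?p * (?p / 4)\<^sup>2"
      using N(1) by (simp add: field_simps power2_eq_square power3_eq_cube)
    then show "1 / (16 * real N ^ 3) * real (card K) ^ 3 \<le> (\<Sum>a\<in>K. (?h a)\<^sup>2)"
      using lower by linarith
  qed (use f W1 in auto)
qed

text \<open>
  Every finite subgroup \<open>K\<close> has characters that are bounded away from \<open>1\<close> at its points near \<open>x0\<close> and are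
  equicontinuous, with the constant \<open>c\<close> and the moduli \<open>W\<close> and \<open>U\<close> independent of \<open>K\<close>.  This
  uniformity is what lets the characters pass to a limit.
\<close>

definition uniform_separation ::
    "'a::topological_ab_group_add \<Rightarrow> real \<Rightarrow> 'a set \<Rightarrow> (real \<Rightarrow> 'a set) \<Rightarrow> bool" where
  "uniform_separation x0 c W U \<longleftrightarrow>
     c > 0 \<and> open W \<and> 0 \<in> W \<and> (\<forall>\<delta>>0. open (U \<delta>) \<and> 0 \<in> U \<delta>) \<and>
     (\<forall>K y. add_subgroup K \<longrightarrow> finite K \<longrightarrow> y \<in> K \<longrightarrow> y - x0 \<in> W \<longrightarrow>
       (\<exists>\<theta>. char_on K \<theta> \<and> c \<le> 1 - Re (\<theta> y) \<and> (\<forall>\<delta>>0. \<forall>u\<in>K \<inter> U \<delta>. cmod (\<theta> u - 1) \<le> \<delta>)))"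

lemma ex_uniform_separation:
  fixes x0 :: "'a::{topological_ab_group_add, t2_space}"
  assumes cpt: "compact (UNIV :: 'a set)" and x0: "x0 \<noteq> 0"
  shows "\<exists>c W U. uniform_separation x0 c W U"
proof -
  obtain f :: "'a \<Rightarrow> real" and c W where f: "continuous_on UNIV f" "\<And>x. \<bar>f x\<bar> \<le> 1"
    and c: "c > 0" and W: "open W" "0 \<in> W"
    and zero: "\<And>K y. add_subgroup K \<Longrightarrow> finite K \<Longrightarrow> y \<in> K \<Longrightarrow> y - x0 \<in> W \<Longrightarrow>
       (\<Sum>a\<in>K. (\<Sum>b\<in>K. f (b + (a + y)) * f b) * (\<Sum>b\<in>K. f (b + a) * f b)) = 0"
    and big: "\<And>K. add_subgroup K \<Longrightarrow> finite K \<Longrightarrow>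
       c * real (card K) ^ 3 \<le> (\<Sum>a\<in>K. (\<Sum>b\<in>K. f (b + a) * f b)\<^sup>2)"
    using ex_bump[OF cpt x0] by blast
  \<comment> \<open>\<open>s\<close> bounds the coefficient below per point of \<open>K\<close>, so an oscillation of \<open>\<delta> * s\<close> keeps the character within \<open>\<delta>\<close> of \<open>1\<close>.\<close>
  define s where "s = sqrt (c / 4)"
  have s: "s > 0" using c by (simp add: s_def)
  have "\<forall>\<delta>. \<exists>U. \<delta> > 0 \<longrightarrow> open U \<and> 0 \<in> U \<and> (\<forall>u\<in>U. \<forall>b. \<bar>f (b + u) - f b\<bar> < \<delta> * s)"
    using uniform_continuity_translation[OF cpt f(1)] s by (metis mult_pos_pos)
  then obtain U where U: "\<And>\<delta>. \<delta> > 0 \<Longrightarrow> open (U \<delta>) \<and> 0 \<in> U \<delta> \<and> (\<forall>u\<in>U \<delta>. \<forall>b. \<bar>f (b + u) - f b\<bar> < \<delta> * s)"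
    by metis
  show ?thesis
  unfolding uniform_separation_def
  proof (intro exI[of _ "c / 2"] exI[of _ W] exI[of _ U] conjI allI impI)
    fix K y assume K: "add_subgroup K" "finite K" and y: "y \<in> K" "y - x0 \<in> W"
    let ?F = "\<lambda>x. complex_of_real (f x)"
    obtain \<theta> where \<theta>: "char_on K \<theta>" "c / 2 \<le> 1 - Re (\<theta> y)"
      and large: "c / 4 * (real (card K))\<^sup>2 \<le> (cmod (finite_coeff K ?F \<theta>))\<^sup>2"
      using ex_char_large_coeff[OF K y(1) f(2) zero[OF K y] big[OF K] c] by auto
    have n: "real (card K) > 0" using K add_subgroup_zero[OF K(1)] by (auto simp: card_gt_0_iff)
    have "(s * real (card K))\<^sup>2 \<le> (cmod (finite_coeff K ?F \<theta>))\<^sup>2"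
      using large c by (simp add: s_def power_mult_distrib)
    then have large': "s * real (card K) \<le> cmod (finite_coeff K ?F \<theta>)"
      by (rule power2_le_imp_le) simp
    have "cmod (\<theta> u - 1) \<le> \<delta>" if "\<delta> > 0" "u \<in> K \<inter> U \<delta>" for \<delta> u
    proof -
      have "cmod (?F (b + u) - ?F b) \<le> \<delta> * s" for b
        using U[OF that(1)] that(2) by (auto simp flip: of_real_diff intro: less_imp_le)
      then have "cmod (\<theta> u - 1) * cmod (finite_coeff K ?F \<theta>) \<le> \<delta> * s * real (card K)"
        using that by (intro char_near_one[OF K(1) \<theta>(1)]) auto
      moreover have "cmod (\<theta> u - 1) * (s * real (card K)) \<le> cmod (\<theta> u - 1) * cmod (finite_coeff K ?F \<theta>)"
        using large' by (intro mult_left_mono) auto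
      ultimately have "cmod (\<theta> u - 1) * (s * real (card K)) \<le> \<delta> * (s * real (card K))" by simp
      then show ?thesis by (rule mult_right_le_imp_le) (use s n in simp)
    qed
    then show "\<exists>\<theta>. char_on K \<theta> \<and> c / 2 \<le> 1 - Re (\<theta> y) \<and> (\<forall>\<delta>>0. \<forall>u\<in>K \<inter> U \<delta>. cmod (\<theta> u - 1) \<le> \<delta>)"
      using \<theta> by blast
  qed (use c W U in auto)
qed

text \<open>
  Approximate a point by a sequence in \<open>D\<close>.  Equicontinuity at \<open>0\<close> makes the values of \<open>\<theta>\<close> along the sequence
  a Cauchy sequence, and makes the limit independent of the sequence.
\<close>

lemma char_extend_dense:
  fixes D :: "'a::{topological_ab_group_add, second_countable_topology, t2_space} set"
  assumes D: "add_subgroup D" "closure D = UNIV" and \<theta>: "char_on D \<theta>"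
    and U: "\<And>\<delta>. \<delta> > 0 \<Longrightarrow> open (U \<delta>)" "\<And>\<delta>. \<delta> > 0 \<Longrightarrow> 0 \<in> U \<delta>"
      "\<And>\<delta> u. \<delta> > 0 \<Longrightarrow> u \<in> D \<Longrightarrow> u \<in> U \<delta> \<Longrightarrow> cmod (\<theta> u - 1) \<le> \<delta>"
  shows "\<exists>\<xi>\<in>dual_group. (\<forall>x\<in>D. \<xi> x = \<theta> x) \<and> (\<forall>\<delta>>0. \<forall>u\<in>U \<delta>. cmod (\<xi> u - 1) \<le> \<delta>)"
proof -
  have "\<forall>x. \<exists>s. (\<forall>n::nat. s n \<in> D) \<and> s \<longlonglongrightarrow> x"
    using D(2) closure_sequential[of _ D] by auto
  then obtain s where s: "\<And>x n. s x n \<in> D" "\<And>x. s x \<longlonglongrightarrow> x" by metis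
  have dist_\<theta>: "cmod (\<theta> d - \<theta> e) = cmod (\<theta> (d - e) - 1)" if "d \<in> D" "e \<in> D" for d e
  proof -
    have "\<theta> (d - e) * \<theta> e = \<theta> d"
      using char_on_add[OF \<theta>, of "d - e" e] that add_subgroup_diff[OF D(1)] by simp
    then have "\<theta> d - \<theta> e = (\<theta> (d - e) - 1) * \<theta> e" by (simp add: algebra_simps)
    then show ?thesis using char_on_norm[OF \<theta> that(2)] by (simp add: norm_mult)
  qed
  have conv: "convergent (\<lambda>n. \<theta> (s x n))" for x
  proof -
    have "Cauchy (\<lambda>n. \<theta> (s x n))"
    proof (rule metric_CauchyI)
      fix e :: real assume "e > 0"
      then obtain V where V: "open V" "0 \<in> V" "\<And>u v. u \<in> V \<Longrightarrow> v \<in> V \<Longrightarrow> u - v \<in> U (e / 2)"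
        using nhd_zero_diff[of "U (e / 2)"] U by (metis half_gt_zero)
      have "(\<lambda>n. s x n - x) \<longlonglongrightarrow> x - x" by (intro tendsto_intros s)
      then have "eventually (\<lambda>n. s x n - x \<in> V) sequentially"
        using V by (intro topological_tendstoD) auto
      then obtain N where N: "\<And>n. n \<ge> N \<Longrightarrow> s x n - x \<in> V"
        by (auto simp: eventually_sequentially)
      show "\<exists>N. \<forall>m\<ge>N. \<forall>n\<ge>N. dist (\<theta> (s x m)) (\<theta> (s x n)) < e"
      proof (intro exI allI impI)
        fix m n assume "m \<ge> N" "n \<ge> N"
        then have "s x m - s x n \<in> U (e / 2)" using V(3)[OF N N] by fastforce
        then have "cmod (\<theta> (s x m - s x n) - 1) \<le> e / 2"
          using \<open>e > 0\<close> by (intro U(3) add_subgroup_diff[OF D(1)] s(1)) auto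
        then show "dist (\<theta> (s x m)) (\<theta> (s x n)) < e"
          using \<open>e > 0\<close> by (simp add: dist_norm dist_\<theta>[OF s(1) s(1)])
      qed
    qed
    then show ?thesis by (rule Cauchy_convergent)
  qed
  define \<xi> where "\<xi> x = lim (\<lambda>n. \<theta> (s x n))" for x
  have \<xi>_lim: "(\<lambda>n. \<theta> (d n)) \<longlonglongrightarrow> \<xi> x" if d: "\<And>n. d n \<in> D" "d \<longlonglongrightarrow> x" for d x
  proof -
    have "(\<lambda>n. \<theta> (d n) - \<theta> (s x n)) \<longlonglongrightarrow> 0"
    proof (rule tendstoI)
      fix e :: real assume "e > 0"
      have "(\<lambda>n. d n - s x n) \<longlonglongrightarrow> x - x" by (intro tendsto_intros s d)
      then have "eventually (\<lambda>n. d n - s x n \<in> U (e / 2)) sequentially"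
        using U \<open>e > 0\<close> by (intro topological_tendstoD) auto
      then show "eventually (\<lambda>n. dist (\<theta> (d n) - \<theta> (s x n)) 0 < e) sequentially"
      proof eventually_elim
        case (elim n)
        then show ?case
          using U(3)[of "e / 2" "d n - s x n"] \<open>e > 0\<close> dist_\<theta>[OF d(1) s(1)] d(1) s(1)
            add_subgroup_diff[OF D(1)] by simp
      qed
    qed
    moreover have "(\<lambda>n. \<theta> (s x n)) \<longlonglongrightarrow> \<xi> x"
      using conv unfolding \<xi>_def by (simp add: convergent_LIMSEQ_iff)
    ultimately show ?thesis using tendsto_add by fastforce
  qed
  have \<xi>_on_D: "\<xi> x = \<theta> x" if "x \<in> D" for x
    using LIMSEQ_unique[OF \<xi>_lim[of "\<lambda>_. x" x] tendsto_const] that by simp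
  have \<xi>_add: "\<xi> (x + y) = \<xi> x * \<xi> y" for x y
  proof -
    have "(\<lambda>n. \<theta> (s x n + s y n)) \<longlonglongrightarrow> \<xi> (x + y)"
      using s add_subgroup_add[OF D(1)] by (intro \<xi>_lim tendsto_add) auto
    moreover have "(\<lambda>n. \<theta> (s x n + s y n)) \<longlonglongrightarrow> \<xi> x * \<xi> y"
      using tendsto_mult[OF \<xi>_lim[OF s(1) s(2)] \<xi>_lim[OF s(1) s(2)], of x y]
      by (simp add: char_on_add[OF \<theta> s(1) s(1)])
    ultimately show ?thesis by (rule LIMSEQ_unique)
  qed
  have \<xi>_norm: "cmod (\<xi> x) = 1" for x
  proof -
    have "(\<lambda>n. cmod (\<theta> (s x n))) \<longlonglongrightarrow> cmod (\<xi> x)" by (intro tendsto_norm \<xi>_lim s)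
    then show ?thesis by (simp add: char_on_norm[OF \<theta> s(1)] LIMSEQ_const_iff)
  qed
  have \<xi>_close: "cmod (\<xi> u - 1) \<le> \<delta>" if "\<delta> > 0" "u \<in> U \<delta>" for \<delta> u
  proof (rule LIMSEQ_le_const2)
    show "(\<lambda>n. cmod (\<theta> (s u n) - 1)) \<longlonglongrightarrow> cmod (\<xi> u - 1)"
      by (intro tendsto_intros \<xi>_lim s)
    have "eventually (\<lambda>n. s u n \<in> U \<delta>) sequentially"
      using s(2) U that by (intro topological_tendstoD) auto
    then show "\<exists>N. \<forall>n\<ge>N. cmod (\<theta> (s u n) - 1) \<le> \<delta>"
      unfolding eventually_sequentially using U(3)[OF that(1) s(1)] by blast
  qed
  have "isCont \<xi> x" for x
    unfolding continuous_at
  proof (rule tendstoI)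
    fix e :: real assume e: "e > 0"
    have "eventually (\<lambda>z. z \<in> {z. z - x \<in> U (e / 2)}) (at x)"
      by (rule topological_tendstoD[OF tendsto_ident_at open_translate_vimage])
         (use U e in auto)
    then show "eventually (\<lambda>z. dist (\<xi> z) (\<xi> x) < e) (at x)"
    proof eventually_elim
      case (elim z)
      have "\<xi> z - \<xi> x = (\<xi> (z - x) - 1) * \<xi> x"
        using \<xi>_add[of "z - x" x] by (simp add: algebra_simps)
      then have "dist (\<xi> z) (\<xi> x) = cmod (\<xi> (z - x) - 1)"
        by (simp add: dist_norm norm_mult \<xi>_norm)
      also have "\<dots> \<le> e / 2" using \<xi>_close[of "e / 2" "z - x"] elim e by simp
      finally show ?case using e by simp
    qed
  qed
  then have "\<xi> \<in> dual_group"
    unfolding dual_group_def using \<xi>_norm \<xi>_add by (auto simp: continuous_on_eq_continuous_at)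
  then show ?thesis using \<xi>_on_D \<xi>_close by blast
qed

text \<open>
  The bounds of \<open>uniform_separation\<close> are applied at a point \<open>y\<close> of the union that is close to \<open>x0\<close>, because \<open>x0\<close>
  itself may lie in no \<open>K j\<close>.  A diagonal subsequence of the resulting characters converges on the
  countable dense union, and equicontinuity carries the separation from \<open>y\<close> over to \<open>x0\<close>.
\<close>

lemma chars_separate_zero:
  fixes x0 :: "'a::{topological_ab_group_add, second_countable_topology, t2_space}"
  assumes cpt: "compact (UNIV :: 'a set)" and x0: "x0 \<noteq> 0"
    and K: "\<And>j::nat. add_subgroup (K j :: 'a set)" "\<And>j. finite (K j)" "incseq K" "closure (\<Union>j. K j) = UNIV"
  shows "\<exists>\<xi>\<in>dual_group. \<xi> x0 \<noteq> 1"
proof -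
  obtain c W and U :: "real \<Rightarrow> 'a set" where cWU: "uniform_separation x0 c W U"
    using ex_uniform_separation[OF cpt x0] by blast
  then have c: "c > 0" and W: "open W" "0 \<in> W"
    and U: "\<And>\<delta>. \<delta> > 0 \<Longrightarrow> open (U \<delta>)" "\<And>\<delta>. \<delta> > 0 \<Longrightarrow> 0 \<in> U \<delta>"
    by (simp_all add: uniform_separation_def)
  have ex: "\<exists>\<theta>. char_on K \<theta> \<and> c \<le> 1 - Re (\<theta> y) \<and> (\<forall>\<delta>>0. \<forall>u\<in>K \<inter> U \<delta>. cmod (\<theta> u - 1) \<le> \<delta>)"
    if "add_subgroup K" "finite K" "y \<in> K" "y - x0 \<in> W" for K y
    using cWU that unfolding uniform_separation_def by blast
  define D where "D = (\<Union>j. K j)"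
  have mono: "K i \<subseteq> K j" if "i \<le> j" for i j using K(3) that by (rule monoD)
  have D: "add_subgroup D"
    unfolding add_subgroup_def
  proof (intro conjI ballI)
    show "0 \<in> D" using add_subgroup_zero[OF K(1)] by (auto simp: D_def)
    fix x y assume "x \<in> D" "y \<in> D"
    then obtain i j where "x \<in> K i" "y \<in> K j" by (auto simp: D_def)
    then have "x \<in> K (max i j)" "y \<in> K (max i j)"
      using mono[of i "max i j"] mono[of j "max i j"] by auto
    then show "x - y \<in> D" using add_subgroup_diff[OF K(1)] by (auto simp: D_def)
  qed
  have "open ({y. y - x0 \<in> W} \<inter> {y. y - x0 \<in> U (c / 2)})"
    using W U c by (intro open_Int open_translate_vimage) auto
  moreover have "x0 \<in> {y. y - x0 \<in> W} \<inter> {y. y - x0 \<in> U (c / 2)}" using W U c by auto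
  ultimately have "D \<inter> ({y. y - x0 \<in> W} \<inter> {y. y - x0 \<in> U (c / 2)}) \<noteq> {}"
    using closure_iff_nhds_not_empty[of x0 D] K(4)
    unfolding D_def[symmetric] by blast
  then obtain y where y: "y \<in> D" "y - x0 \<in> W" "y - x0 \<in> U (c / 2)" by auto
  then obtain j0 where j0: "y \<in> K j0" by (auto simp: D_def)
  \<comment> \<open>Skipping the first groups makes \<open>y\<close> a member of all of them.\<close>
  define L where "L j = K (j + j0)" for j
  have L: "add_subgroup (L j)" "finite (L j)" "y \<in> L j" for j
    using K(1,2) j0 mono[of j0 "j + j0"] by (auto simp: L_def)
  have L_mono: "L i \<subseteq> L j" if "i \<le> j" for i j using mono that by (simp add: L_def)
  have "\<forall>j. \<exists>\<theta>. char_on (L j) \<theta> \<and> c \<le> 1 - Re (\<theta> y) \<and> (\<forall>\<delta>>0. \<forall>u\<in>L j \<inter> U \<delta>. cmod (\<theta> u - 1) \<le> \<delta>)"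
    using ex[OF L y(2)] by blast
  from choice[OF this] obtain \<theta> where \<theta>_all: "\<forall>j. char_on (L j) (\<theta> j) \<and> c \<le> 1 - Re (\<theta> j y) \<and>
      (\<forall>\<delta>>0. \<forall>u\<in>L j \<inter> U \<delta>. cmod (\<theta> j u - 1) \<le> \<delta>)"
    by blast
  then have \<theta>: "\<And>j. char_on (L j) (\<theta> j)" "\<And>j. c \<le> 1 - Re (\<theta> j y)"
    "\<And>j \<delta> u. \<delta> > 0 \<Longrightarrow> u \<in> L j \<Longrightarrow> u \<in> U \<delta> \<Longrightarrow> cmod (\<theta> j u - 1) \<le> \<delta>"
    by auto
  have in_L: "\<exists>N. \<forall>n\<ge>N. x \<in> L n" if x: "x \<in> D" for x
  proof -
    obtain i where "x \<in> K i" using x by (auto simp: D_def)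
    then have "x \<in> L i" using mono[of i "i + j0"] by (auto simp: L_def)
    then show ?thesis using L_mono by blast
  qed
  \<comment> \<open>The value \<open>1\<close> off \<open>L j\<close> is a default within the unit disc: every point of \<open>D\<close> eventually lies in \<open>L j\<close>.\<close>
  define F where "F j x = (if x \<in> L j then \<theta> j x else 1)" for j x
  have "countable D" unfolding D_def using K(2) by (auto intro: countable_finite)
  moreover have "norm (F j x) \<le> 1" for j x using char_on_norm[OF \<theta>(1)] by (auto simp: F_def)
  ultimately obtain k where k: "strict_mono (k::nat\<Rightarrow>nat)"
      "\<And>x. x \<in> D \<Longrightarrow> \<exists>l. (\<lambda>n. F (k n) x) \<longlonglongrightarrow> l"
    using function_convergent_subsequence[of D F 1] by metis
  then obtain l where l: "\<And>x. x \<in> D \<Longrightarrow> (\<lambda>n. F (k n) x) \<longlonglongrightarrow> l x" by metis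
  have ev: "eventually (\<lambda>n. x \<in> L (k n)) sequentially" if "x \<in> D" for x
    using in_L[OF that] k(1) unfolding eventually_sequentially
    by (meson order_trans seq_suble)
  have lim: "(\<lambda>n. \<theta> (k n) x) \<longlonglongrightarrow> l x" if "x \<in> D" for x
    by (rule Lim_transform_eventually[OF l[OF that]])
       (use ev[OF that] in \<open>auto simp: F_def elim: eventually_mono\<close>)
  have ch: "char_on D l"
    unfolding char_on_def
  proof (intro conjI ballI)
    fix x assume x: "x \<in> D"
    have "eventually (\<lambda>n. cmod (\<theta> (k n) x) = 1) sequentially"
      using ev[OF x] by eventually_elim (rule char_on_norm[OF \<theta>(1)])
    then show "cmod (l x) = 1"
      by (intro LIMSEQ_unique[OF tendsto_norm[OF lim[OF x]]] tendsto_eventually)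
    fix y assume y: "y \<in> D"
    have "eventually (\<lambda>n. \<theta> (k n) x * \<theta> (k n) y = \<theta> (k n) (x + y)) sequentially"
      using ev[OF x] ev[OF y] by eventually_elim (simp add: char_on_add[OF \<theta>(1)])
    then have "(\<lambda>n. \<theta> (k n) (x + y)) \<longlonglongrightarrow> l x * l y"
      by (rule Lim_transform_eventually[OF tendsto_mult[OF lim[OF x] lim[OF y]]])
    then show "l (x + y) = l x * l y"
      by (rule LIMSEQ_unique[OF lim[OF add_subgroup_add[OF D x y]]])
  qed
  have l_close: "cmod (l u - 1) \<le> \<delta>" if "\<delta> > 0" "u \<in> D" "u \<in> U \<delta>" for \<delta> u
  proof (rule tendsto_upperbound)
    show "(\<lambda>n. cmod (\<theta> (k n) u - 1)) \<longlonglongrightarrow> cmod (l u - 1)"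
      by (intro tendsto_intros lim that)
    show "eventually (\<lambda>n. cmod (\<theta> (k n) u - 1) \<le> \<delta>) sequentially"
      using ev[OF that(2)] by eventually_elim (rule \<theta>(3)[OF that(1) _ that(3)])
  qed auto
  have "c \<le> 1 - Re (l y)"
    by (rule tendsto_lowerbound[of "\<lambda>n. 1 - Re (\<theta> (k n) y)" _ sequentially])
       (use \<theta>(2) in \<open>auto intro!: tendsto_intros lim y\<close>)
  have "closure D = UNIV" using K(4) by (simp add: D_def)
  then have "\<exists>\<xi>\<in>dual_group. (\<forall>x\<in>D. \<xi> x = l x) \<and> (\<forall>\<delta>>0. \<forall>u\<in>U \<delta>. cmod (\<xi> u - 1) \<le> \<delta>)"
    using U l_close by (intro char_extend_dense[OF D _ ch]) auto
  then obtain \<xi> where \<xi>: "\<xi> \<in> dual_group" "\<forall>x\<in>D. \<xi> x = l x"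
    "\<forall>\<delta>>0. \<forall>u\<in>U \<delta>. cmod (\<xi> u - 1) \<le> \<delta>"
    by blast
  have "\<xi> x0 \<noteq> 1"
  proof
    assume "\<xi> x0 = 1"
    moreover have "\<xi> y = \<xi> (y - x0) * \<xi> x0"
    proof -
      have "\<xi> (y - x0 + x0) = \<xi> (y - x0) * \<xi> x0" using \<xi>(1) unfolding dual_group_def by blast
      then show ?thesis by simp
    qed
    ultimately have "l y = \<xi> (y - x0)" using \<xi>(2) y(1) by simp
    then have "cmod (l y - 1) \<le> c / 2" using \<xi>(3)[THEN spec, of "c / 2"] y(3) c by simp
    then have "1 - Re (l y) \<le> c / 2"
      using abs_Re_le_cmod[of "l y - 1"] by simp
    then show False using \<open>c \<le> 1 - Re (l y)\<close> c by simp
  qed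
  then show ?thesis using \<xi>(1) by blast
qed

section \<open>Haar measure and uniqueness of Fourier coefficients\<close>

lemma haar_space:
  assumes "normalized_haar (M :: 'a::topological_ab_group_add measure)"
  shows "space M = UNIV"
  using assms sets_eq_imp_space_eq[of M borel] by (simp add: normalized_haar_def)

lemma haar_measurable:
  assumes "normalized_haar (M :: 'a::topological_ab_group_add measure)"
  shows "measurable M N = measurable borel N"
  using assms by (intro measurable_cong_sets) (auto simp: normalized_haar_def)

lemma haar_finite:
  assumes "normalized_haar (M :: 'a::topological_ab_group_add measure)"
  shows "finite_measure M" "measure M UNIV = 1"
proof -
  show "finite_measure M"
    by (rule finite_measureI) (use assms in \<open>simp add: haar_space[OF assms] normalized_haar_def\<close>)
  show "measure M UNIV = 1"
    using assms by (simp add: measure_def normalized_haar_def)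
qed

lemma continuous_translation:
  "continuous_on UNIV (\<lambda>x. y + x :: 'a::topological_ab_group_add)"
  unfolding continuous_on_def by (intro ballI tendsto_intros)

lemma haar_translation_measurable:
  assumes "normalized_haar (M :: 'a::topological_ab_group_add measure)"
  shows "(\<lambda>x. y + x) \<in> measurable M M"
proof -
  have "(\<lambda>x. y + x) \<in> measurable (borel :: 'a measure) borel"
    by (rule borel_measurable_continuous_onI[OF continuous_translation])
  then show ?thesis
    using assms by (simp add: normalized_haar_def cong: measurable_cong_sets)
qed

lemma haar_integral_translation:
  fixes f :: "'a::topological_ab_group_add \<Rightarrow> 'b::{banach, second_countable_topology}"
  assumes M: "normalized_haar M" and f: "f \<in> borel_measurable M"
  shows "(LINT x|M. f (y + x)) = (LINT x|M. f x)"
    and "integrable M (\<lambda>x. f (y + x)) \<longleftrightarrow> integrable M f"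
proof -
  have d: "distr M M (\<lambda>x. y + x) = M" using M by (simp add: normalized_haar_def)
  show "(LINT x|M. f (y + x)) = (LINT x|M. f x)"
    using integral_distr[OF haar_translation_measurable[OF M] f, of y] by (simp add: d)
  show "integrable M (\<lambda>x. f (y + x)) \<longleftrightarrow> integrable M f"
    using integrable_distr_eq[OF haar_translation_measurable[OF M] f, of y] by (simp add: d)
qed

lemma haar_AE_translation:
  fixes M :: "'a::topological_ab_group_add measure"
  assumes M: "normalized_haar M" and ae: "AE x in M. P x"
  shows "AE x in M. P (y + x)"
proof -
  have d: "distr M M (\<lambda>x. y + x) = M" using M by (simp add: normalized_haar_def)
  then have "AE x in distr M M (\<lambda>x. y + x). P x" using ae by metis
  then show ?thesis by (rule AE_distrD[OF haar_translation_measurable[OF M]])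
qed

lemma dual_groupD:
  assumes "\<xi> \<in> dual_group"
  shows "continuous_on UNIV \<xi>" "cmod (\<xi> x) = 1" "\<xi> (x + y) = \<xi> x * \<xi> y" "char_on H \<xi>"
  using assms by (auto simp: dual_group_def char_on_def)

lemma dual_group_mult: "\<xi> \<in> dual_group \<Longrightarrow> \<eta> \<in> dual_group \<Longrightarrow> (\<lambda>x. \<xi> x * \<eta> x) \<in> dual_group"
  and dual_group_cnj: "\<xi> \<in> dual_group \<Longrightarrow> (\<lambda>x. cnj (\<xi> x)) \<in> dual_group"
  and dual_group_one: "(\<lambda>x. 1) \<in> dual_group"
  by (auto simp: dual_group_def norm_mult intro!: continuous_intros)

lemma dual_group_measurable:
  assumes "normalized_haar M" "\<xi> \<in> dual_group"
  shows "\<xi> \<in> borel_measurable M"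
  using borel_measurable_continuous_onI[OF dual_groupD(1)[OF assms(2)]]
  by (simp add: haar_measurable[OF assms(1)])

lemma integrable_mult_bounded:
  fixes f g :: "'a \<Rightarrow> complex"
  assumes "integrable M f" "g \<in> borel_measurable M" "\<And>x. cmod (g x) \<le> B"
  shows "integrable M (\<lambda>x. g x * f x)"
proof (rule Bochner_Integration.integrable_bound)
  show "integrable M (\<lambda>x. B * cmod (f x))" using assms(1) by auto
  show "(\<lambda>x. g x * f x) \<in> borel_measurable M" using assms by auto
  show "AE x in M. norm (g x * f x) \<le> norm (B * cmod (f x))"
  proof (rule AE_I2)
    fix x
    have "B \<ge> 0" using assms(3)[of x] norm_ge_zero order_trans by blast
    then show "norm (g x * f x) \<le> norm (B * cmod (f x))"
      using assms(3)[of x] by (simp add: norm_mult mult_right_mono)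
  qed
qed

lemma integrable_mult_cnj_dual:
  assumes "normalized_haar M" "integrable M h" "\<xi> \<in> dual_group"
  shows "integrable M (\<lambda>x. h x * cnj (\<xi> x))"
  using integrable_mult_bounded[OF assms(2) dual_group_measurable[OF assms(1) dual_group_cnj[OF assms(3)]], of 1]
    dual_groupD(2)[OF assms(3)] by (simp add: mult.commute)

lemma integrable_dual_group:
  assumes M: "normalized_haar M" and \<xi>: "\<xi> \<in> dual_group"
  shows "integrable M \<xi>"
proof -
  interpret finite_measure M by (rule haar_finite[OF M])
  show ?thesis
    by (rule integrable_const_bound[of _ 1])
       (use dual_groupD[OF \<xi>] dual_group_measurable[OF M \<xi>] in auto)
qed

lemma dual_group_cnj_mult_self: "\<xi> \<in> dual_group \<Longrightarrow> \<xi> x * cnj (\<xi> x) = 1"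
  using char_on_cnj[OF dual_groupD(4), of \<xi> x UNIV] by simp

text \<open>
  Invariance of the measure multiplies the integral of a nontrivial character by one of its values
  different from \<open>1\<close>.
\<close>

lemma dual_group_orthonormal:
  assumes M: "normalized_haar M" and \<xi>: "\<xi> \<in> dual_group" and \<eta>: "\<eta> \<in> dual_group"
  shows "(LINT x|M. \<xi> x * cnj (\<eta> x)) = (if \<xi> = \<eta> then 1 else 0)"
proof (cases "\<xi> = \<eta>")
  case True
  then show ?thesis
    using dual_group_cnj_mult_self[OF \<eta>] haar_finite(2)[OF M] by (simp add: haar_space[OF M])
next
  case False
  then obtain y where y: "\<xi> y \<noteq> \<eta> y" by blast
  let ?\<zeta> = "\<lambda>x. \<xi> x * cnj (\<eta> x)"
  have \<zeta>: "?\<zeta> \<in> dual_group" using \<xi> \<eta> by (intro dual_group_mult dual_group_cnj)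
  have "(LINT x|M. ?\<zeta> x) = (LINT x|M. ?\<zeta> (y + x))"
    by (rule haar_integral_translation(1)[OF M dual_group_measurable[OF M \<zeta>], symmetric])
  also have "\<dots> = (LINT x|M. ?\<zeta> y * ?\<zeta> x)"
    by (simp only: dual_groupD(3)[OF \<zeta>])
  also have "\<dots> = ?\<zeta> y * (LINT x|M. ?\<zeta> x)" by (rule integral_mult_right_zero)
  finally have "?\<zeta> y = 1 \<or> (LINT x|M. ?\<zeta> x) = 0" by auto
  moreover have "?\<zeta> y \<noteq> 1"
  proof
    assume "?\<zeta> y = 1"
    then have "?\<zeta> y * \<eta> y = \<eta> y" by simp
    then have "\<xi> y * (\<eta> y * cnj (\<eta> y)) = \<eta> y" by (simp only: mult_ac)
    then show False using y dual_group_cnj_mult_self[OF \<eta>] by simp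
  qed
  ultimately show ?thesis using False by simp
qed

text \<open>
  By complete regularity, \<open>O'\<close> is the union of the closures of those members of a countable basis
  whose closure it contains.
\<close>

lemma ex_closed_exhaustion:
  fixes O' :: "'a::{second_countable_topology, t2_space} set"
  assumes cpt: "compact (UNIV :: 'a set)" and O': "open O'"
  shows "\<exists>C :: nat \<Rightarrow> 'a set. (\<forall>n. closed (C n)) \<and> incseq C \<and> (\<Union>n. C n) = O'"
proof -
  obtain B :: "'a set set" where B: "countable B" "topological_basis B"
    using ex_countable_basis by blast
  define \<C> where "\<C> = {b \<in> B. closure b \<subseteq> O'}"
  have inner: "\<exists>b\<in>\<C>. x \<in> b" if x: "x \<in> O'" for x
  proof -
    obtain g :: "'a \<Rightarrow> real" where g: "continuous_on UNIV g" "\<And>x. x \<in> - O' \<Longrightarrow> g x = 0" "\<And>y. y \<in> {x} \<Longrightarrow> g y = 1"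
    proof -
      have "closed (- O')" "closed {x}" "- O' \<inter> {x} = {}" using O' x by auto
      from urysohn_compact[OF cpt this] that show ?thesis by metis
    qed
    have "open (g -` {1/2<..})" by (intro open_vimage g) auto
    moreover have "x \<in> g -` {1/2<..}" using g(3) by simp
    ultimately obtain b where b: "b \<in> B" "x \<in> b" "b \<subseteq> g -` {1/2<..}"
      by (rule topological_basisE[OF B(2)])
    have "closed (g -` {1/2..})" using g(1) by (intro closed_vimage) auto
    moreover have "b \<subseteq> g -` {1/2..}" using b(3) by auto
    ultimately have "closure b \<subseteq> g -` {1/2..}" by (rule closure_minimal[rotated])
    also have "\<dots> \<subseteq> O'" using g(2) by force
    finally show ?thesis using b by (auto simp: \<C>_def)
  qed
  \<comment> \<open>Adding the empty set guarantees a nonempty set to enumerate, also when \<open>O'\<close> is empty.\<close>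
  define e where "e = from_nat_into (insert {} \<C>)"
  have "countable (insert {} \<C>)" using B(1) by (simp add: \<C>_def)
  then have range_e: "range e = insert {} \<C>"
    unfolding e_def by (intro range_from_nat_into) auto
  define C where "C n = (\<Union>k\<le>n. closure (e k))" for n :: nat
  have "closed (C n)" for n by (simp add: C_def closed_UN)
  moreover have "incseq C" unfolding C_def incseq_def by (fastforce intro: order_trans)
  moreover have "(\<Union>n. C n) = O'"
  proof
    have "closure (e k) \<subseteq> O'" for k
    proof -
      have "e k \<in> insert {} \<C>" using range_e by blast
      then show ?thesis by (auto simp: \<C>_def)
    qed
    then show "(\<Union>n. C n) \<subseteq> O'" by (auto simp: C_def)
    show "O' \<subseteq> (\<Union>n. C n)"
    proof
      fix x assume "x \<in> O'"
      then obtain b where b: "b \<in> \<C>" "x \<in> b" using inner by blast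
      then have "b \<in> range e" using range_e by auto
      then obtain k where "b = e k" by auto
      then have "x \<in> C k" using b closure_subset by (auto simp: C_def)
      then show "x \<in> (\<Union>n. C n)" by blast
    qed
  qed
  ultimately show ?thesis by blast
qed

text \<open>
  Urysohn functions approximate the indicator of an open set pointwise, and open sets generate the
  Borel sets, so the integral of \<open>f\<close> over every Borel set vanishes.
\<close>

lemma ae_zero_if_orthogonal_to_continuous:
  fixes f :: "'a::{second_countable_topology, t2_space} \<Rightarrow> complex"
  assumes cpt: "compact (UNIV :: 'a set)" and M: "sets M = sets borel" "finite_measure M"
    and f: "integrable M f"
    and orth: "\<And>g :: 'a \<Rightarrow> real. continuous_on UNIV g \<Longrightarrow> (LINT x|M. g x *\<^sub>R f x) = 0"
  shows "AE x in M. f x = 0"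
proof -
  interpret finite_measure M by (rule M(2))
  have UN: "space M = UNIV" using sets_eq_imp_space_eq[OF M(1)] by simp
  have meas: "measurable M (borel :: real measure) = measurable borel borel"
    using M(1) by (intro measurable_cong_sets) auto
  have si: "set_integrable M A f" if "A \<in> sets M" for A
    unfolding set_integrable_def by (rule integrable_mult_indicator[OF that f])
  have opens: "set_lebesgue_integral M A f = 0" if A: "open A" for A
  proof -
    obtain C :: "nat \<Rightarrow> 'a set" where C: "\<And>n. closed (C n)" "incseq C" "(\<Union>n. C n) = A"
      using ex_closed_exhaustion[OF cpt A] by blast
    have "\<forall>n. \<exists>g :: 'a \<Rightarrow> real. continuous_on UNIV g \<and> (\<forall>x. 0 \<le> g x \<and> g x \<le> 1) \<and>
        (\<forall>x\<in>- A. g x = 0) \<and> (\<forall>x\<in>C n. g x = 1)"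
    proof
      fix n
      have "closed (- A)" "- A \<inter> C n = {}" using A C(3) by auto
      then show "\<exists>g :: 'a \<Rightarrow> real. continuous_on UNIV g \<and> (\<forall>x. 0 \<le> g x \<and> g x \<le> 1) \<and>
        (\<forall>x\<in>- A. g x = 0) \<and> (\<forall>x\<in>C n. g x = 1)"
        using urysohn_compact[OF cpt _ C(1), of "- A" n] by metis
    qed
    from choice[OF this] obtain g :: "nat \<Rightarrow> 'a \<Rightarrow> real" where
      g: "\<forall>n. continuous_on UNIV (g n) \<and> (\<forall>x. 0 \<le> g n x \<and> g n x \<le> 1) \<and>
        (\<forall>x\<in>- A. g n x = 0) \<and> (\<forall>x\<in>C n. g n x = 1)" by blast
    have lim: "(\<lambda>n. g n x) \<longlonglongrightarrow> indicator A x" for x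
    proof (cases "x \<in> A")
      case True
      then obtain N where "x \<in> C N" using C(3) by auto
      then have "\<forall>n\<ge>N. x \<in> C n" using incseqD[OF C(2)] by blast
      then have "\<forall>n\<ge>N. g n x = 1" using g by blast
      then show ?thesis
        using True by (intro tendsto_eventually) (auto simp: eventually_sequentially)
    qed (use g in simp)
    have "(\<lambda>n. LINT x|M. g n x *\<^sub>R f x) \<longlonglongrightarrow> (LINT x|M. indicator A x *\<^sub>R f x)"
    proof (rule integral_dominated_convergence[where w = "\<lambda>x. norm (f x)"])
      show "(\<lambda>x. indicat_real A x *\<^sub>R f x) \<in> borel_measurable M"
        using f A M(1) by (intro borel_measurable_scaleR borel_measurable_indicator) auto
      show "(\<lambda>x. g n x *\<^sub>R f x) \<in> borel_measurable M" for n
      proof -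
        have "g n \<in> borel_measurable M"
          using g by (auto simp: meas intro: borel_measurable_continuous_onI)
        then show ?thesis using f by auto
      qed
      show "AE x in M. norm (g n x *\<^sub>R f x) \<le> norm (f x)" for n
        using g by (intro AE_I2) (simp add: mult_left_le_one_le)
      show "AE x in M. (\<lambda>n. g n x *\<^sub>R f x) \<longlonglongrightarrow> indicator A x *\<^sub>R f x"
        using lim by (intro AE_I2 tendsto_scaleR) auto
    qed (use f in auto)
    moreover have "(LINT x|M. g n x *\<^sub>R f x) = 0" for n using g by (intro orth) auto
    ultimately show ?thesis
      unfolding set_lebesgue_integral_def using LIMSEQ_unique[OF _ tendsto_const] by simp
  qed
  have "set_lebesgue_integral M A f = 0" if "A \<in> sets M" for A
  proof -
    have "Int_stable {S :: 'a set. open S}" "{S :: 'a set. open S} \<subseteq> Pow UNIV"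
      "A \<in> sigma_sets UNIV {S. open S}"
      using that M(1) by (auto simp: Int_stable_def sets_borel)
    then show ?thesis
    proof (induction rule: sigma_sets_induct_disjoint)
      case (basic A)
      then show ?case using opens by simp
    next
      case (compl A)
      then have A: "A \<in> sets M" using M(1) by (simp add: sets_borel)
      have "set_lebesgue_integral M (A \<union> (UNIV - A)) f
          = set_lebesgue_integral M A f + set_lebesgue_integral M (UNIV - A) f"
        by (rule set_integral_Un) (use A sets.compl_sets[OF A] UN in \<open>auto intro: si\<close>)
      moreover have "A \<union> (UNIV - A) = UNIV" by auto
      ultimately show ?case using compl opens[of UNIV] by simp
    next
      case (union A)
      then have A: "A i \<in> sets M" for i using M(1) by (auto simp: sets_borel)
      have "set_lebesgue_integral M (\<Union>i. A i) f = (\<Sum>i. set_lebesgue_integral M (A i) f)"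
        by (rule lebesgue_integral_countable_add)
           (use A union in \<open>auto simp: disjoint_family_on_def intro!: si\<close>)
      then show ?case using union by simp
    qed (auto simp: set_lebesgue_integral_def)
  qed
  then show ?thesis by (rule density_zero[OF f])
qed

text \<open>
  The functions \<open>h\<close> all of whose coefficients vanish form a module over the multipliers \<open>P\<close>, and these
  multipliers form an algebra that contains the real and imaginary parts of characters.
  Stone-Weierstrass therefore applies to \<open>P\<close>, and its density in the continuous functions suffices.
\<close>

lemma fourier_uniqueness:
  fixes f :: "'a::{topological_ab_group_add, second_countable_topology, t2_space} \<Rightarrow> complex"
  assumes cpt: "compact (UNIV :: 'a set)" and M: "normalized_haar M"
    and sep: "\<And>x::'a. x \<noteq> 0 \<Longrightarrow> \<exists>\<xi>\<in>dual_group. \<xi> x \<noteq> 1"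
    and f: "integrable M f" and zero: "\<And>\<xi>. \<xi> \<in> dual_group \<Longrightarrow> fourier_coeff M f \<xi> = 0"
  shows "AE x in M. f x = 0"
proof (rule ae_zero_if_orthogonal_to_continuous[OF cpt _ haar_finite(1)[OF M] f])
  show "sets M = sets borel" using M by (simp add: normalized_haar_def)
  define \<N> where "\<N> = {h. integrable M h \<and> (\<forall>\<xi>\<in>dual_group. fourier_coeff M h \<xi> = 0)}"
  define P where "P g \<longleftrightarrow> continuous_on UNIV g \<and> (\<forall>h\<in>\<N>. (\<lambda>x. g x *\<^sub>R h x) \<in> \<N>)" for g :: "'a \<Rightarrow> real"
  have f\<N>: "f \<in> \<N>" using f zero by (simp add: \<N>_def)
  have \<N>_add: "(\<lambda>x. h x + k x) \<in> \<N>" if "h \<in> \<N>" "k \<in> \<N>" for h k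
    using that integrable_mult_cnj_dual[OF M] by (simp add: \<N>_def fourier_coeff_def distrib_right)
  have \<N>_scale: "(\<lambda>x. c * h x) \<in> \<N>" if "h \<in> \<N>" for h c
    using that by (simp add: \<N>_def fourier_coeff_def mult.assoc)
  have \<N>_dual: "(\<lambda>x. \<xi> x * h x) \<in> \<N>" if h: "h \<in> \<N>" and \<xi>: "\<xi> \<in> dual_group" for h \<xi>
    unfolding \<N>_def
  proof (intro CollectI conjI ballI)
    show "integrable M (\<lambda>x. \<xi> x * h x)"
      using h dual_groupD(2)[OF \<xi>] dual_group_measurable[OF M \<xi>]
      by (intro integrable_mult_bounded[of _ _ _ 1]) (auto simp: \<N>_def)
    fix \<eta> :: "'a \<Rightarrow> complex" assume \<eta>: "\<eta> \<in> dual_group"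
    have "fourier_coeff M (\<lambda>x. \<xi> x * h x) \<eta> = fourier_coeff M h (\<lambda>x. \<eta> x * cnj (\<xi> x))"
      by (simp add: fourier_coeff_def mult_ac)
    also have "\<dots> = 0"
      using h dual_group_mult[OF \<eta> dual_group_cnj[OF \<xi>]] by (auto simp: \<N>_def)
    finally show "fourier_coeff M (\<lambda>x. \<xi> x * h x) \<eta> = 0" .
  qed
  have P_Re: "P (\<lambda>x. Re (\<xi> x))" if \<xi>: "\<xi> \<in> dual_group" for \<xi>
    unfolding P_def
  proof (intro conjI ballI)
    show "continuous_on UNIV (\<lambda>x. Re (\<xi> x))" using dual_groupD(1)[OF \<xi>] by (intro continuous_intros)
    fix h assume h: "h \<in> \<N>"
    have "(\<lambda>x. Re (\<xi> x) *\<^sub>R h x) = (\<lambda>x. (1/2) * (\<xi> x * h x) + (1/2) * (cnj (\<xi> x) * h x))"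
      by (auto simp: fun_eq_iff complex_eq_iff field_simps)
    then show "(\<lambda>x. Re (\<xi> x) *\<^sub>R h x) \<in> \<N>"
      using \<N>_add[OF \<N>_scale[OF \<N>_dual[OF h \<xi>]] \<N>_scale[OF \<N>_dual[OF h dual_group_cnj[OF \<xi>]]]]
      by (simp only:)
  qed
  have P_Im: "P (\<lambda>x. Im (\<xi> x))" if \<xi>: "\<xi> \<in> dual_group" for \<xi>
    unfolding P_def
  proof (intro conjI ballI)
    show "continuous_on UNIV (\<lambda>x. Im (\<xi> x))" using dual_groupD(1)[OF \<xi>] by (intro continuous_intros)
    fix h assume h: "h \<in> \<N>"
    have "(\<lambda>x. Im (\<xi> x) *\<^sub>R h x) = (\<lambda>x. (-\<i>/2) * (\<xi> x * h x) + (\<i>/2) * (cnj (\<xi> x) * h x))"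
      by (auto simp: fun_eq_iff complex_eq_iff field_simps)
    then show "(\<lambda>x. Im (\<xi> x) *\<^sub>R h x) \<in> \<N>"
      using \<N>_add[OF \<N>_scale[OF \<N>_dual[OF h \<xi>]] \<N>_scale[OF \<N>_dual[OF h dual_group_cnj[OF \<xi>]]]]
      by (simp only:)
  qed
  have P_const: "P (\<lambda>x. c)" for c
    using \<N>_scale[of _ "of_real c"] by (simp add: P_def scaleR_conv_of_real)
  have P_add: "P (\<lambda>x. g x + k x)" if "P g \<and> P k" for g k
    using that \<N>_add by (auto simp: P_def scaleR_add_left intro!: continuous_intros)
  have P_mult: "P (\<lambda>x. g x * k x)" if "P g \<and> P k" for g k
    using that by (auto simp: P_def simp flip: scaleR_scaleR intro!: continuous_intros)
  have P_separates: "\<exists>g. P g \<and> g x \<noteq> g y" if "x \<in> UNIV \<and> y \<in> UNIV \<and> x \<noteq> y" for x y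
  proof -
    have "x - y \<noteq> 0" using that by simp
    from sep[OF this] obtain \<xi> where \<xi>: "\<xi> \<in> dual_group" "\<xi> (x - y) \<noteq> 1" by blast
    have "\<xi> x \<noteq> \<xi> y"
      using \<xi> char_on_diff[OF _ dual_groupD(4)[OF \<xi>(1)], of UNIV x y] dual_group_cnj_mult_self[OF \<xi>(1)]
      by (auto simp: add_subgroup_def)
    then have "Re (\<xi> x) \<noteq> Re (\<xi> y) \<or> Im (\<xi> x) \<noteq> Im (\<xi> y)" by (auto simp: complex_eq_iff)
    then show ?thesis using P_Re[OF \<xi>(1)] P_Im[OF \<xi>(1)] by blast
  qed
  fix g :: "'a \<Rightarrow> real" assume g: "continuous_on UNIV g"
  have g_meas: "g' \<in> borel_measurable M" if "continuous_on UNIV g'" for g' :: "'a \<Rightarrow> real"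
    using borel_measurable_continuous_onI[OF that] by (simp add: haar_measurable[OF M])
  have small: "norm (LINT x|M. g x *\<^sub>R f x) \<le> e * (LINT x|M. norm (f x))" if e: "e > 0" for e
  proof -
    obtain k where k: "P k" "\<And>x. \<bar>g x - k x\<bar> < e"
      using Stone_Weierstrass_HOL[OF cpt P_const _ P_add P_mult P_separates g e] unfolding P_def
      by (metis UNIV_I)
    have k\<N>: "(\<lambda>x. k x *\<^sub>R f x) \<in> \<N>" using k(1) f\<N> by (simp add: P_def)
    have "(LINT x|M. k x *\<^sub>R f x) = 0"
      using k\<N> dual_group_one by (auto simp: \<N>_def fourier_coeff_def dest!: bspec[of _ _ "\<lambda>x. 1"])
    have int_diff: "integrable M (\<lambda>x. (g x - k x) *\<^sub>R f x)"
    proof (rule Bochner_Integration.integrable_bound)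
      show "integrable M (\<lambda>x. e * norm (f x))" using f by auto
      show "(\<lambda>x. (g x - k x) *\<^sub>R f x) \<in> borel_measurable M"
        using g_meas[OF g] g_meas[of k] k(1) f by (auto simp: P_def)
      show "AE x in M. norm ((g x - k x) *\<^sub>R f x) \<le> norm (e * norm (f x))"
        using e by (intro AE_I2) (auto simp: abs_mult intro!: mult_right_mono less_imp_le[OF k(2)])
    qed
    have "(LINT x|M. g x *\<^sub>R f x) = (LINT x|M. (g x - k x) *\<^sub>R f x + k x *\<^sub>R f x)"
      by (simp add: scaleR_diff_left)
    also have "\<dots> = (LINT x|M. (g x - k x) *\<^sub>R f x)"
      using int_diff k\<N> \<open>(LINT x|M. k x *\<^sub>R f x) = 0\<close> by (simp add: \<N>_def)
    finally have "norm (LINT x|M. g x *\<^sub>R f x) \<le> (LINT x|M. norm ((g x - k x) *\<^sub>R f x))"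
      using integral_norm_bound by metis
    also have "\<dots> \<le> (LINT x|M. e * norm (f x))"
      using integrable_norm[OF int_diff] f by (intro integral_mono) (auto intro!: mult_right_mono less_imp_le[OF k(2)])
    finally show ?thesis by simp
  qed
  have "norm (LINT x|M. g x *\<^sub>R f x) \<le> 0"
  proof (rule field_le_epsilon)
    fix d :: real assume d: "d > 0"
    define I where "I = (LINT x|M. norm (f x))"
    have "I \<ge> 0" by (simp add: I_def)
    then have "d / (I + 1) * I \<le> d" using d by (simp add: field_simps)
    moreover have "d / (I + 1) > 0" using d \<open>I \<ge> 0\<close> by simp
    ultimately show "norm (LINT x|M. g x *\<^sub>R f x) \<le> 0 + d"
      using small[of "d / (I + 1)"] unfolding I_def by linarith
  qed
  then show "(LINT x|M. g x *\<^sub>R f x) = 0" by simp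
qed

section \<open>Trigonometric polynomials and their translates\<close>

definition trig_poly :: "('a \<Rightarrow> complex) set \<Rightarrow> (('a \<Rightarrow> complex) \<Rightarrow> complex) \<Rightarrow> 'a \<Rightarrow> complex" where
  "trig_poly S c = (\<lambda>x. \<Sum>\<xi>\<in>S. c \<xi> * \<xi> x)"

text \<open>
  Trigonometric polynomials with frequencies in \<open>S\<close>, up to equality almost everywhere.
\<close>

definition trig_space ::
    "'a measure \<Rightarrow> ('a \<Rightarrow> complex) set \<Rightarrow> ('a \<Rightarrow> complex) set" where
  "trig_space M S = L2_span M S (\<lambda>\<xi>. \<xi>)"

lemma trig_space_iff: "f \<in> trig_space M S \<longleftrightarrow> f \<in> L2 M \<and> (\<exists>c. AE x in M. f x = trig_poly S c x)"
  by (simp add: trig_space_def L2_span_def trig_poly_def)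

lemma trig_poly_measurable:
  assumes "normalized_haar M" "S \<subseteq> dual_group"
  shows "trig_poly S c \<in> borel_measurable M"
  unfolding trig_poly_def
  using assms by (intro borel_measurable_sum borel_measurable_times borel_measurable_const dual_group_measurable) auto

lemma trig_poly_bound:
  assumes "S \<subseteq> dual_group"
  shows "cmod (trig_poly S c x) \<le> (\<Sum>\<xi>\<in>S. cmod (c \<xi>))"
  unfolding trig_poly_def using assms
  by (intro sum_norm_le) (auto simp: norm_mult subset_eq dual_groupD(2))

lemma trig_poly_in_L2:
  assumes M: "normalized_haar M" and S: "S \<subseteq> dual_group"
  shows "trig_poly S c \<in> L2 M"
proof -
  interpret finite_measure M by (rule haar_finite(1)[OF M])
  have "(cmod (trig_poly S c x))\<^sup>2 \<le> (\<Sum>\<xi>\<in>S. cmod (c \<xi>))\<^sup>2" for x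
    using trig_poly_bound[OF S] by (intro power_mono) auto
  then have "integrable M (\<lambda>x. (cmod (trig_poly S c x))\<^sup>2)"
    using trig_poly_measurable[OF M S]
    by (intro integrable_const_bound[of _ "(\<Sum>\<xi>\<in>S. cmod (c \<xi>))\<^sup>2"]) auto
  then show ?thesis using trig_poly_measurable[OF M S] by (simp add: L2_def)
qed

lemma L2_inner_trig_poly:
  assumes M: "normalized_haar M" and S: "finite S" "S \<subseteq> dual_group" and T: "finite T" "T \<subseteq> dual_group"
  shows "L2_inner M (trig_poly S c) (trig_poly T d) = (\<Sum>\<xi>\<in>S \<inter> T. c \<xi> * cnj (d \<xi>))"
proof -
  have int: "integrable M (\<lambda>x. c \<xi> * cnj (d \<eta>) * (\<xi> x * cnj (\<eta> x)))" if "\<xi> \<in> S" "\<eta> \<in> T" for \<xi> \<eta>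
    using that S T by (intro integrable_mult_right integrable_dual_group[OF M] dual_group_mult dual_group_cnj) auto
  have "L2_inner M (trig_poly S c) (trig_poly T d)
      = (LINT x|M. (\<Sum>\<xi>\<in>S. \<Sum>\<eta>\<in>T. c \<xi> * cnj (d \<eta>) * (\<xi> x * cnj (\<eta> x))))"
    unfolding L2_inner_def trig_poly_def cnj_sum sum_product
    by (intro Bochner_Integration.integral_cong refl sum.cong) simp
  also have "\<dots> = (\<Sum>\<xi>\<in>S. \<Sum>\<eta>\<in>T. (LINT x|M. c \<xi> * cnj (d \<eta>) * (\<xi> x * cnj (\<eta> x))))"
    using int by (subst Bochner_Integration.integral_sum)
      (auto intro!: Bochner_Integration.integrable_sum sum.cong Bochner_Integration.integral_sum)
  also have "\<dots> = (\<Sum>\<xi>\<in>S. \<Sum>\<eta>\<in>T. if \<xi> = \<eta> then c \<xi> * cnj (d \<eta>) else 0)"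
    using S T by (intro sum.cong refl) (auto simp: dual_group_orthonormal[OF M] subset_eq)
  also have "\<dots> = (\<Sum>\<xi>\<in>S. if \<xi> \<in> T then c \<xi> * cnj (d \<xi>) else 0)"
    using T by (intro sum.cong refl) auto
  also have "\<dots> = (\<Sum>\<xi>\<in>S \<inter> T. c \<xi> * cnj (d \<xi>))"
    using S by (simp add: sum.inter_restrict)
  finally show ?thesis .
qed

lemma fourier_coeff_trig_poly:
  assumes M: "normalized_haar M" and S: "finite S" "S \<subseteq> dual_group" and \<eta>: "\<eta> \<in> dual_group"
  shows "fourier_coeff M (trig_poly S c) \<eta> = (if \<eta> \<in> S then c \<eta> else 0)"
proof -
  have "fourier_coeff M (trig_poly S c) \<eta> = L2_inner M (trig_poly S c) (trig_poly {\<eta>} (\<lambda>_. 1))"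
    by (simp add: fourier_coeff_def L2_inner_def trig_poly_def)
  also have "\<dots> = (if \<eta> \<in> S then c \<eta> else 0)"
    using L2_inner_trig_poly[OF M S, of "{\<eta>}" c "\<lambda>_. 1"] \<eta> by simp
  finally show ?thesis .
qed

lemma freq_supp_trig_poly:
  assumes M: "normalized_haar M" and S: "finite S" "S \<subseteq> dual_group"
    and c: "\<And>\<xi>. \<xi> \<in> S \<Longrightarrow> c \<xi> \<noteq> 0"
  shows "freq_supp M (trig_poly S c) = S"
  using S c fourier_coeff_trig_poly[OF M S, of _ c]
  by (auto simp: freq_supp_def subset_eq split: if_splits)

lemma L2_inner_cong_AE:
  assumes "f \<in> borel_measurable M" "f' \<in> borel_measurable M" "g \<in> borel_measurable M" "g' \<in> borel_measurable M"
    and "AE x in M. f x = f' x" "AE x in M. g x = g' x"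
  shows "L2_inner M f g = L2_inner M f' g'"
proof -
  have cnj: "(\<lambda>x. cnj (k x)) \<in> borel_measurable M" if "k \<in> borel_measurable M" for k
    by (rule measurable_compose[OF that])
       (intro borel_measurable_continuous_onI continuous_on_cnj continuous_on_id)
  show ?thesis
    unfolding L2_inner_def
    by (intro integral_cong_AE borel_measurable_times assms cnj)
       (use assms(5,6) in eventually_elim, simp)
qed

lemma fourier_coeff_cong_AE:
  assumes "normalized_haar M" "f \<in> borel_measurable M" "f' \<in> borel_measurable M" "AE x in M. f x = f' x"
    "\<eta> \<in> dual_group"
  shows "fourier_coeff M f \<eta> = fourier_coeff M f' \<eta>"
  using L2_inner_cong_AE[OF assms(2,3) _ _ assms(4), of \<eta> \<eta>] dual_group_measurable[OF assms(1,5)]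
  by (simp add: fourier_coeff_def L2_inner_def)

lemma L2_integrable:
  assumes "finite_measure M" "f \<in> L2 M"
  shows "integrable M f"
proof (rule Bochner_Integration.integrable_bound)
  interpret finite_measure M by fact
  show "integrable M (\<lambda>x. 1 + (cmod (f x))\<^sup>2)" using assms(2) by (auto simp: L2_def)
  show "f \<in> borel_measurable M" using assms(2) by (simp add: L2_def)
  have "t \<le> 1 + t\<^sup>2" for t :: real
    using zero_le_power2[of "t - 1/2"] by (simp add: power2_eq_square algebra_simps)
  then show "AE x in M. norm (f x) \<le> norm (1 + (cmod (f x))\<^sup>2)" by (intro AE_I2) simp
qed

lemma L2_add:
  assumes "f \<in> L2 M" "g \<in> L2 M"
  shows "(\<lambda>x. f x + g x) \<in> L2 M"
proof -
  have meas: "(\<lambda>x. f x + g x) \<in> borel_measurable M" using assms by (auto simp: L2_def)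
  have "integrable M (\<lambda>x. (cmod (f x + g x))\<^sup>2)"
  proof (rule Bochner_Integration.integrable_bound)
    show "integrable M (\<lambda>x. 2 * (cmod (f x))\<^sup>2 + 2 * (cmod (g x))\<^sup>2)"
      using assms by (auto simp: L2_def)
    have "(cmod (f x + g x))\<^sup>2 \<le> 2 * (cmod (f x))\<^sup>2 + 2 * (cmod (g x))\<^sup>2" for x
    proof -
      have "(cmod (f x + g x))\<^sup>2 \<le> (cmod (f x) + cmod (g x))\<^sup>2"
        by (intro power_mono norm_triangle_ineq) auto
      also have "\<dots> \<le> 2 * (cmod (f x))\<^sup>2 + 2 * (cmod (g x))\<^sup>2"
        using zero_le_power2[of "cmod (f x) - cmod (g x)"] by (simp add: power2_eq_square algebra_simps)
      finally show ?thesis .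
    qed
    then show "AE x in M. norm ((cmod (f x + g x))\<^sup>2) \<le> norm (2 * (cmod (f x))\<^sup>2 + 2 * (cmod (g x))\<^sup>2)"
      by (intro AE_I2) simp
  qed (use meas in auto)
  then show ?thesis using meas by (simp add: L2_def)
qed

lemma L2_scale: "f \<in> L2 M \<Longrightarrow> (\<lambda>x. c * f x) \<in> L2 M"
  by (auto simp: L2_def norm_mult power_mult_distrib)

lemma L2_diff: "f \<in> L2 M \<Longrightarrow> g \<in> L2 M \<Longrightarrow> (\<lambda>x. f x - g x) \<in> L2 M"
  using L2_add[of f M "\<lambda>x. (-1) * g x"] L2_scale[of g M "-1"] by simp

lemma translate_in_L2:
  assumes M: "normalized_haar M" and f: "f \<in> L2 M"
  shows "translate a f \<in> L2 M"
proof -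
  have meas: "f \<in> borel_measurable M" "(\<lambda>x. (cmod (f x))\<^sup>2) \<in> borel_measurable M"
    using f by (auto simp: L2_def)
  have "(\<lambda>x. f (- a + x)) \<in> borel_measurable M"
    using measurable_compose[OF haar_translation_measurable[OF M] meas(1)] .
  moreover have "integrable M (\<lambda>x. (cmod (f (- a + x)))\<^sup>2)"
    using haar_integral_translation(2)[OF M meas(2), of "- a"] f by (simp add: L2_def)
  ultimately show ?thesis by (simp add: L2_def translate_def)
qed

lemma translate_trig_poly:
  assumes "S \<subseteq> dual_group"
  shows "translate a (trig_poly S c) = trig_poly S (\<lambda>\<xi>. c \<xi> * cnj (\<xi> a))"
proof -
  have "\<xi> (x - a) = \<xi> x * cnj (\<xi> a)" if "\<xi> \<in> S" for \<xi> x
    using assms that by (intro char_on_diff[of UNIV] dual_groupD(4)) (auto simp: add_subgroup_def)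
  then show ?thesis
    by (auto simp: translate_def trig_poly_def fun_eq_iff mult_ac intro!: sum.cong)
qed

lemma translate_AE:
  assumes M: "normalized_haar M" and ae: "AE x in M. f x = g x"
  shows "AE x in M. translate a f x = translate a g x"
  using haar_AE_translation[OF M ae, of "- a"] by (simp add: translate_def)

lemma sum_translates_AE:
  assumes M: "normalized_haar M" and S: "finite S" "S \<subseteq> dual_group" and H: "finite H"
    and \<phi>: "AE x in M. \<phi> x = trig_poly S c x"
  shows "AE x in M. (\<Sum>a\<in>H. d a * translate a \<phi> x)
           = trig_poly S (\<lambda>\<xi>. c \<xi> * (\<Sum>a\<in>H. d a * cnj (\<xi> a))) x"
proof -
  have "AE x in M. \<forall>a\<in>H. translate a \<phi> x = trig_poly S (\<lambda>\<xi>. c \<xi> * cnj (\<xi> a)) x"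
    using H translate_AE[OF M \<phi>]
    by (intro AE_finite_allI) (auto simp: translate_trig_poly[OF S(2)])
  then show ?thesis
  proof eventually_elim
    case (elim x)
    have "(\<Sum>a\<in>H. d a * translate a \<phi> x) = (\<Sum>a\<in>H. \<Sum>\<xi>\<in>S. d a * (c \<xi> * cnj (\<xi> a) * \<xi> x))"
      using elim by (simp add: trig_poly_def sum_distrib_left)
    also have "\<dots> = (\<Sum>\<xi>\<in>S. \<Sum>a\<in>H. d a * (c \<xi> * cnj (\<xi> a) * \<xi> x))" by (rule sum.swap)
    also have "\<dots> = trig_poly S (\<lambda>\<xi>. c \<xi> * (\<Sum>a\<in>H. d a * cnj (\<xi> a))) x"
      by (auto simp: trig_poly_def sum_distrib_left sum_distrib_right mult_ac intro!: sum.cong)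
    finally show ?case .
  qed
qed

text \<open>
  A combination of distinct characters of \<open>H\<close> returns its coefficients under the Fourier transform
  on \<open>H\<close>.
\<close>

lemma sum_chars_coeff:
  assumes H: "add_subgroup H" and F: "finite F" "distinct_on H F" "\<And>\<eta>. \<eta> \<in> F \<Longrightarrow> char_on H \<eta>"
    and \<xi>: "\<xi> \<in> F"
  shows "(\<Sum>a\<in>H. (\<Sum>\<eta>\<in>F. e \<eta> * \<eta> a) * cnj (\<xi> a)) = e \<xi> * of_nat (card H)"
proof -
  have "(\<Sum>a\<in>H. (\<Sum>\<eta>\<in>F. e \<eta> * \<eta> a) * cnj (\<xi> a)) = (\<Sum>a\<in>H. \<Sum>\<eta>\<in>F. e \<eta> * (\<eta> a * cnj (\<xi> a)))"
    unfolding sum_distrib_right mult.assoc ..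
  also have "\<dots> = (\<Sum>\<eta>\<in>F. e \<eta> * (\<Sum>a\<in>H. \<eta> a * cnj (\<xi> a)))"
    unfolding sum_distrib_left by (rule sum.swap)
  also have "\<dots> = (\<Sum>\<eta>\<in>F. if \<eta> = \<xi> then e \<xi> * of_nat (card H) else 0)"
  proof (intro sum.cong refl)
    fix \<eta> assume \<eta>: "\<eta> \<in> F"
    have "(\<forall>x\<in>H. \<eta> x = \<xi> x) \<longleftrightarrow> \<eta> = \<xi>" using F(2) \<eta> \<xi> by (auto simp: distinct_on_def)
    then show "e \<eta> * (\<Sum>a\<in>H. \<eta> a * cnj (\<xi> a)) = (if \<eta> = \<xi> then e \<xi> * of_nat (card H) else 0)"
      using char_orthogonality[OF H F(3)[OF \<eta>] F(3)[OF \<xi>]] by auto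
  qed
  also have "\<dots> = e \<xi> * of_nat (card H)" using F(1) \<xi> by simp
  finally show ?thesis .
qed

text \<open>
  On coefficients, a combination of translates of \<open>\<phi>\<close> is multiplication by the Fourier transform of
  the weights \<open>d\<close> on \<open>H\<close>.  As the frequencies are distinct on \<open>H\<close>, finite Fourier inversion finds
  weights with any prescribed transform.
\<close>

lemma span_translates_eq_trig_space:
  assumes M: "normalized_haar M" and S: "finite S" "S \<subseteq> dual_group"
    and H: "add_subgroup H" "finite H" and dist: "distinct_on H S"
    and \<phi>: "AE x in M. \<phi> x = trig_poly S c x" and c: "\<And>\<xi>. \<xi> \<in> S \<Longrightarrow> c \<xi> \<noteq> 0"
  shows "L2_span M H (\<lambda>a. translate a \<phi>) = trig_space M S"
proof (intro equalityI subsetI)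
  fix f assume "f \<in> L2_span M H (\<lambda>a. translate a \<phi>)"
  then obtain d where f: "f \<in> L2 M" "AE x in M. f x = (\<Sum>a\<in>H. d a * translate a \<phi> x)"
    by (auto simp: L2_span_def)
  have "AE x in M. f x = trig_poly S (\<lambda>\<xi>. c \<xi> * (\<Sum>a\<in>H. d a * cnj (\<xi> a))) x"
    using f(2) sum_translates_AE[OF M S H(2) \<phi>, of d] by eventually_elim simp
  then show "f \<in> trig_space M S" using f(1) unfolding trig_space_iff by blast
next
  fix f assume "f \<in> trig_space M S"
  then obtain e where f: "f \<in> L2 M" "AE x in M. f x = trig_poly S e x"
    by (auto simp: trig_space_iff)
  define n where "n = complex_of_nat (card H)"
  have n: "n \<noteq> 0" using H add_subgroup_zero[OF H(1)] by (auto simp: n_def card_eq_0_iff)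
  define d where "d a = (\<Sum>\<eta>\<in>S. (e \<eta> / (c \<eta> * n)) * \<eta> a)" for a
  have "c \<xi> * (\<Sum>a\<in>H. d a * cnj (\<xi> a)) = e \<xi>" if \<xi>: "\<xi> \<in> S" for \<xi>
  proof -
    have "char_on H \<eta>" if "\<eta> \<in> S" for \<eta> using that S(2) dual_groupD(4) by blast
    from sum_chars_coeff[OF H(1) S(1) dist this \<xi>, of "\<lambda>\<eta>. e \<eta> / (c \<eta> * n)"]
    have "(\<Sum>a\<in>H. d a * cnj (\<xi> a)) = e \<xi> / (c \<xi> * n) * n"
      unfolding d_def n_def .
    then show ?thesis using n c[OF \<xi>] by simp
  qed
  then have "trig_poly S (\<lambda>\<xi>. c \<xi> * (\<Sum>a\<in>H. d a * cnj (\<xi> a))) = trig_poly S e"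
    by (auto simp: trig_poly_def fun_eq_iff intro!: sum.cong)
  then have "AE x in M. f x = (\<Sum>a\<in>H. d a * translate a \<phi> x)"
    using f(2) sum_translates_AE[OF M S H(2) \<phi>, of d] by (auto elim: eventually_elim2)
  then show "f \<in> L2_span M H (\<lambda>a. translate a \<phi>)"
    using f(1) by (auto simp: L2_span_def)
qed

text \<open>
  Extension by zero turns agreement on \<open>H\<close> into equality of functions, so that fibres of the
  restriction map are ordinary fibres.
\<close>

definition restrict_char :: "'a set \<Rightarrow> ('a \<Rightarrow> complex) \<Rightarrow> 'a \<Rightarrow> complex" where
  "restrict_char H \<xi> = (\<lambda>x. if x \<in> H then \<xi> x else 0)"

lemma restrict_char_eq_iff: "restrict_char H \<xi> = restrict_char H \<eta> \<longleftrightarrow> (\<forall>x\<in>H. \<xi> x = \<eta> x)"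
  by (auto simp: restrict_char_def fun_eq_iff)

lemma distinct_on_iff_inj_on: "distinct_on H S \<longleftrightarrow> inj_on (restrict_char H) S"
  by (simp add: distinct_on_def inj_on_def restrict_char_eq_iff)

lemma distinct_on_restrict_char_image: "distinct_on H (restrict_char H ` S)"
  by (auto simp: distinct_on_def restrict_char_def fun_eq_iff)

lemma char_on_restrict_char:
  assumes "add_subgroup H" "char_on H \<xi>" shows "char_on H (restrict_char H \<xi>)"
  using assms add_subgroup_add[OF assms(1)] by (auto simp: char_on_def restrict_char_def)

text \<open>
  Let \<open>F\<close> be the set of restrictions to \<open>H\<close>.  The weights \<open>d\<close> are the part of the point mass at \<open>0\<close>
  orthogonal to \<open>F\<close>, so the corresponding combination of translates vanishes.  Independence gives
  \<open>d 0 = 0\<close>, which says that \<open>F\<close> has \<open>card H\<close> elements: no two characters in \<open>S\<close> have the same restriction.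
\<close>

lemma independent_translates_imp_distinct_on:
  assumes M: "normalized_haar M" and S: "finite S" "S \<subseteq> dual_group"
    and H: "add_subgroup H" "finite H" and card: "card S = card H"
    and \<phi>: "AE x in M. \<phi> x = trig_poly S c x"
    and indep: "\<And>d. AE x in M. (\<Sum>a\<in>H. d a * translate a \<phi> x) = 0 \<Longrightarrow> \<forall>a\<in>H. d a = 0"
  shows "distinct_on H S"
proof -
  define F where "F = restrict_char H ` S"
  have F: "finite F" "distinct_on H F" "\<And>\<eta>. \<eta> \<in> F \<Longrightarrow> char_on H \<eta>"
    using S dual_groupD(4) by (auto simp: F_def distinct_on_restrict_char_image intro!: char_on_restrict_char[OF H(1)])
  define n where "n = complex_of_nat (card H)"
  have H0: "0 \<in> H" using add_subgroup_zero[OF H(1)] .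
  have n: "n \<noteq> 0" using H H0 by (auto simp: n_def card_eq_0_iff)
  define d where "d a = (if a = 0 then 1 else 0) - (\<Sum>\<eta>\<in>F. (1 / n) * \<eta> a)" for a
  have coeff: "(\<Sum>a\<in>H. d a * cnj (\<xi> a)) = 0" if \<xi>: "\<xi> \<in> S" for \<xi>
  proof -
    have "(\<Sum>a\<in>H. (\<Sum>\<eta>\<in>F. (1 / n) * \<eta> a) * cnj (\<xi> a))
        = (\<Sum>a\<in>H. (\<Sum>\<eta>\<in>F. (1 / n) * \<eta> a) * cnj (restrict_char H \<xi> a))"
      by (intro sum.cong refl) (simp add: restrict_char_def)
    also have "\<dots> = 1 / n * of_nat (card H)"
      by (rule sum_chars_coeff[OF H(1) F]) (use \<xi> in \<open>auto simp: F_def\<close>)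
    also have "\<dots> = 1" using n by (simp add: n_def)
    finally have 1: "(\<Sum>a\<in>H. (\<Sum>\<eta>\<in>F. (1 / n) * \<eta> a) * cnj (\<xi> a)) = 1" .
    have "\<xi> \<in> dual_group" using \<xi> S by auto
    then have "\<xi> 0 = 1" using char_on_zero[OF H(1) dual_groupD(4)] by blast
    have "(\<Sum>a\<in>H. (if a = 0 then 1 else 0) * cnj (\<xi> a)) = (\<Sum>a\<in>H. if a = 0 then 1 else 0)"
      using \<open>\<xi> 0 = 1\<close> by (intro sum.cong) auto
    also have "\<dots> = 1" using H H0 by simp
    finally show ?thesis
      using 1 unfolding d_def left_diff_distrib sum_subtractf by simp
  qed
  have "AE x in M. (\<Sum>a\<in>H. d a * translate a \<phi> x) = 0"
    using sum_translates_AE[OF M S H(2) \<phi>, of d] by eventually_elim (simp add: trig_poly_def coeff)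
  from indep[OF this] have "d 0 = 0" using H0 by blast
  moreover have "(\<Sum>\<eta>\<in>F. (1 / n) * \<eta> 0) = of_nat (card F) / n"
    by (simp add: char_on_zero[OF H(1) F(3)])
  ultimately have "complex_of_nat (card F) = n" using n by (simp add: d_def)
  then have "card F = card H" by (simp add: n_def)
  then show ?thesis
    using S(1) card by (simp add: distinct_on_iff_inj_on F_def eq_card_imp_inj_on)
qed

text \<open>
  The inner product is the average over \<open>S\<close> of the values \<open>\<xi> (b - a)\<close>, and the characters in \<open>S\<close> exhaust
  the characters of \<open>H\<close>.
\<close>

lemma orthonormal_translates:
  assumes M: "normalized_haar M" and S: "finite S" "S \<subseteq> dual_group"
    and H: "add_subgroup H" "finite H" and dist: "distinct_on H S" and card: "card S = card H"
    and ab: "a \<in> H" "b \<in> H"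
  defines "\<psi> \<equiv> trig_poly S (\<lambda>_. 1 / of_real (sqrt (card H)))"
  shows "L2_inner M (translate a \<psi>) (translate b \<psi>) = (if a = b then 1 else 0)"
proof -
  let ?r = "complex_of_real (sqrt (card H))"
  have n: "card H > 0" using H add_subgroup_zero[OF H(1)] by (auto simp: card_gt_0_iff)
  have r2: "?r * ?r = of_nat (card H)"
    by (metis of_nat_0_le_iff of_real_mult of_real_of_nat_eq real_sqrt_mult_self abs_of_nonneg)
  have "L2_inner M (translate a \<psi>) (translate b \<psi>)
      = (\<Sum>\<xi>\<in>S. 1 / ?r * cnj (\<xi> a) * cnj (1 / ?r * cnj (\<xi> b)))"
    using L2_inner_trig_poly[OF M S S] by (simp add: \<psi>_def translate_trig_poly[OF S(2)])
  also have "\<dots> = (\<Sum>\<xi>\<in>S. \<xi> (b - a) / of_nat (card H))"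
  proof (intro sum.cong refl)
    fix \<xi> assume "\<xi> \<in> S"
    then have "\<xi> (b - a) = \<xi> b * cnj (\<xi> a)"
      using S(2) H(1) ab by (intro char_on_diff[of H] dual_groupD(4)) auto
    then show "1 / ?r * cnj (\<xi> a) * cnj (1 / ?r * cnj (\<xi> b)) = \<xi> (b - a) / of_nat (card H)"
      by (simp add: r2[symmetric])
  qed
  also have "\<dots> = (\<Sum>\<xi>\<in>S. \<xi> (b - a)) / of_nat (card H)" by (simp add: sum_divide_distrib)
  also have "(\<Sum>\<xi>\<in>S. \<xi> (b - a)) = (if b - a = 0 then of_nat (card H) else 0)"
    using S dual_groupD(4) ab
    by (intro sum_all_chars[OF H S(1) _ dist card] add_subgroup_diff[OF H(1)]) auto
  finally show ?thesis using n by auto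
qed

lemma trig_poly_add: "trig_poly S c x + trig_poly S d x = trig_poly S (\<lambda>\<xi>. c \<xi> + d \<xi>) x"
  by (simp add: trig_poly_def sum.distrib distrib_right)

lemma trig_poly_scale: "k * trig_poly S c x = trig_poly S (\<lambda>\<xi>. k * c \<xi>) x"
  by (simp add: trig_poly_def sum_distrib_left mult.assoc)

lemma trig_space_subspace: "L2_subspace M (trig_space M S)"
  unfolding L2_subspace_def
proof (intro conjI ballI allI)
  show "trig_space M S \<subseteq> L2 M" by (auto simp: trig_space_iff)
  show "(\<lambda>x. 0) \<in> trig_space M S"
    by (auto simp: trig_space_iff trig_poly_def L2_def intro!: exI[of _ "\<lambda>_. 0"])
next
  fix f g assume "f \<in> trig_space M S" "g \<in> trig_space M S"
  then obtain c d where fg: "f \<in> L2 M" "g \<in> L2 M" "AE x in M. f x = trig_poly S c x" "AE x in M. g x = trig_poly S d x"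
    by (auto simp: trig_space_iff)
  have "AE x in M. f x + g x = trig_poly S (\<lambda>\<xi>. c \<xi> + d \<xi>) x"
    using fg(3,4) by eventually_elim (simp add: trig_poly_add)
  then show "(\<lambda>x. f x + g x) \<in> trig_space M S"
    using L2_add[OF fg(1,2)] by (auto simp: trig_space_iff)
next
  fix k f assume "f \<in> trig_space M S"
  then obtain c where f: "f \<in> L2 M" "AE x in M. f x = trig_poly S c x"
    by (auto simp: trig_space_iff)
  have "AE x in M. k * f x = trig_poly S (\<lambda>\<xi>. k * c \<xi>) x"
    using f(2) by eventually_elim (simp add: trig_poly_scale)
  then show "(\<lambda>x. k * f x) \<in> trig_space M S"
    using L2_scale[OF f(1)] by (auto simp: trig_space_iff)
qed

text \<open>
  A member of the large space equals a trigonometric polynomial only almost everywhere, whereas the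
  summands have to add up to it everywhere.  The summand with index \<open>i0\<close> absorbs the difference.
\<close>

lemma trig_space_orthogonal_sum:
  assumes M: "normalized_haar M" and I: "finite I" "i0 \<in> I"
    and P: "\<And>i. i \<in> I \<Longrightarrow> finite (P i)" "\<And>i. i \<in> I \<Longrightarrow> P i \<subseteq> dual_group"
    and disj: "\<And>i k. i \<in> I \<Longrightarrow> k \<in> I \<Longrightarrow> i \<noteq> k \<Longrightarrow> P i \<inter> P k = {}"
  shows "L2_orthogonal_sum M (trig_space M (\<Union>i\<in>I. P i)) I (\<lambda>i. trig_space M (P i))"
  unfolding L2_orthogonal_sum_def
proof (intro conjI ballI impI)
  show "finite I" by fact
  show "L2_subspace M (trig_space M (P i))" for i by (rule trig_space_subspace)
next
  fix i k f g assume ik: "i \<in> I" "k \<in> I" "i \<noteq> k" and "f \<in> trig_space M (P i)" "g \<in> trig_space M (P k)"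
  then obtain c d where fg: "f \<in> L2 M" "g \<in> L2 M" "AE x in M. f x = trig_poly (P i) c x" "AE x in M. g x = trig_poly (P k) d x"
    by (auto simp: trig_space_iff)
  have "L2_inner M f g = L2_inner M (trig_poly (P i) c) (trig_poly (P k) d)"
    using fg trig_poly_measurable[OF M P(2)] ik by (intro L2_inner_cong_AE) (auto simp: L2_def)
  also have "\<dots> = 0" using L2_inner_trig_poly[OF M P[OF ik(1)] P[OF ik(2)]] disj[OF ik] by simp
  finally show "L2_inner M f g = 0" .
next
  let ?S = "\<Union>i\<in>I. P i"
  have split: "trig_poly ?S c x = (\<Sum>i\<in>I. trig_poly (P i) c x)" for c x
    unfolding trig_poly_def using I P disj by (intro sum.UNION_disjoint) auto
  show "trig_space M ?S = {(\<lambda>x. \<Sum>i\<in>I. h i x) | h. \<forall>i\<in>I. h i \<in> trig_space M (P i)}"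
  proof (intro equalityI subsetI)
    fix f assume "f \<in> trig_space M ?S"
    then obtain c where f: "f \<in> L2 M" "AE x in M. f x = trig_poly ?S c x"
      by (auto simp: trig_space_iff)
    define h where "h i = (if i = i0 then (\<lambda>x. f x - trig_poly (\<Union>i\<in>I - {i0}. P i) c x) else trig_poly (P i) c)" for i
    have rest: "trig_poly (\<Union>i\<in>I - {i0}. P i) c x = (\<Sum>i\<in>I - {i0}. trig_poly (P i) c x)" for x
      unfolding trig_poly_def using I P disj by (intro sum.UNION_disjoint) auto
    have "h i \<in> trig_space M (P i)" if i: "i \<in> I" for i
    proof (cases "i = i0")
      case True
      have "trig_poly (\<Union>i\<in>I - {i0}. P i) c \<in> L2 M" using P(2) by (intro trig_poly_in_L2[OF M]) auto
      then have "h i \<in> L2 M" using True L2_diff[OF f(1)] by (simp add: h_def)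
      moreover have "AE x in M. h i x = trig_poly (P i) c x"
        using f(2)
      proof eventually_elim
        case (elim x)
        have "f x = trig_poly (P i0) c x + (\<Sum>i\<in>I - {i0}. trig_poly (P i) c x)"
          using elim split sum.remove[OF I] by metis
        then show ?case using True by (simp add: h_def rest)
      qed
      ultimately show ?thesis by (auto simp: trig_space_iff)
    next
      case False
      then show ?thesis using trig_poly_in_L2[OF M P(2)[OF i]] by (auto simp: h_def trig_space_iff)
    qed
    moreover have "f = (\<lambda>x. \<Sum>i\<in>I. h i x)"
    proof
      fix x
      have "(\<Sum>i\<in>I. h i x) = h i0 x + (\<Sum>i\<in>I - {i0}. h i x)" by (rule sum.remove[OF I])
      also have "(\<Sum>i\<in>I - {i0}. h i x) = (\<Sum>i\<in>I - {i0}. trig_poly (P i) c x)"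
        by (intro sum.cong) (auto simp: h_def)
      finally show "f x = (\<Sum>i\<in>I. h i x)" by (simp add: h_def rest)
    qed
    ultimately show "f \<in> {(\<lambda>x. \<Sum>i\<in>I. h i x) | h. \<forall>i\<in>I. h i \<in> trig_space M (P i)}" by blast
  next
    fix f assume "f \<in> {(\<lambda>x. \<Sum>i\<in>I. h i x) | h. \<forall>i\<in>I. h i \<in> trig_space M (P i)}"
    then obtain h where h: "f = (\<lambda>x. \<Sum>i\<in>I. h i x)" "\<forall>i\<in>I. h i \<in> trig_space M (P i)" by blast
    have mono: "trig_space M (P i) \<subseteq> trig_space M ?S" if i: "i \<in> I" for i
    proof
      fix g assume "g \<in> trig_space M (P i)"
      then obtain c where g: "g \<in> L2 M" "AE x in M. g x = trig_poly (P i) c x" by (auto simp: trig_space_iff)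
      have "trig_poly ?S (\<lambda>\<xi>. if \<xi> \<in> P i then c \<xi> else 0) x = trig_poly (P i) c x" for x
        unfolding trig_poly_def using I P i
        by (intro sum.mono_neutral_cong_right) auto
      then show "g \<in> trig_space M ?S"
        using g unfolding trig_space_iff by (intro conjI exI[of _ "\<lambda>\<xi>. if \<xi> \<in> P i then c \<xi> else 0"]) auto
    qed
    have "(\<lambda>x. \<Sum>i\<in>J. h i x) \<in> trig_space M ?S" if "finite J" "J \<subseteq> I" for J
      using that
    proof (induction J)
      case empty
      then show ?case using trig_space_subspace[of M ?S] by (simp add: L2_subspace_def)
    next
      case (insert j J)
      have "h j \<in> trig_space M ?S" using mono h(2) insert.prems by blast
      moreover have "(\<lambda>x. \<Sum>i\<in>J. h i x) \<in> trig_space M ?S" using insert by simp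
      ultimately have "(\<lambda>x. h j x + (\<Sum>i\<in>J. h i x)) \<in> trig_space M ?S"
        using trig_space_subspace[of M ?S] unfolding L2_subspace_def by metis
      then show ?case using insert.hyps by simp
    qed
    then show "f \<in> trig_space M ?S" using h(1) I(1) by simp
  qed
qed

section \<open>Transversals of the restriction to a kernel\<close>

lemma additive_funpow:
  fixes A :: "'a::ab_group_add \<Rightarrow> 'a"
  assumes "Modules.additive A" shows "Modules.additive (A ^^ j)"
  using assms by (induction j) (auto simp: Modules.additive_def)

lemma add_subgroup_ker_pow:
  assumes "Modules.additive A" shows "add_subgroup (ker_pow A j)"
proof -
  interpret Modules.additive "A ^^ j" by (rule additive_funpow[OF assms])
  show ?thesis by (auto simp: add_subgroup_def ker_pow_def zero diff)
qed

lemma ker_pow_Suc_iff: "x \<in> ker_pow A (Suc j) \<longleftrightarrow> A x \<in> ker_pow A j"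
  by (simp add: ker_pow_def funpow_swap1)

lemma ker_pow_mono:
  assumes "Modules.additive A" shows "incseq (ker_pow A)"
proof (rule incseq_SucI)
  interpret Modules.additive A by fact
  show "ker_pow A j \<subseteq> ker_pow A (Suc j)" for j by (auto simp: ker_pow_def zero)
qed

text \<open>
  \<open>A\<close> maps \<open>ker_pow A (Suc j)\<close> onto \<open>ker_pow A j\<close>, and the fibres are cosets of its kernel.
\<close>

lemma card_ker_pow:
  assumes A: "Modules.additive A" "surj A" and fin: "finite (ker_pow A 1)"
  shows "finite (ker_pow A j) \<and> card (ker_pow A j) = card (ker_pow A 1) ^ j"
proof (induction j)
  case 0
  then show ?case by (simp add: ker_pow_def)
next
  case (Suc j)
  interpret Modules.additive A by (rule A(1))
  have fibre: "finite {x. A x = y} \<and> card {x. A x = y} = card (ker_pow A 1)" for y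
  proof -
    obtain x0 where x0: "A x0 = y" using A(2) by (metis surjD)
    have "bij_betw (\<lambda>a. x0 + a) (ker_pow A 1) {x. A x = y}"
      by (rule bij_betwI[where g = "\<lambda>x. x - x0"]) (auto simp: ker_pow_def add diff x0)
    then show ?thesis using fin bij_betw_finite bij_betw_same_card by metis
  qed
  have un: "ker_pow A (Suc j) = (\<Union>y\<in>ker_pow A j. {x. A x = y})"
    by (auto simp: ker_pow_Suc_iff)
  have "card (\<Union>y\<in>ker_pow A j. {x. A x = y}) = (\<Sum>y\<in>ker_pow A j. card {x. A x = y})"
    using Suc fibre by (intro card_UN_disjoint) auto
  then show ?case
    unfolding un using Suc fibre by (simp add: mult.commute)
qed

text \<open>
  There are at most \<open>card H\<close> restrictions to \<open>H\<close>, and each comes from at most \<open>m\<close> characters in \<open>S\<close> by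
  \<open>card_chars_agreeing_on_subgroup\<close>.  Since \<open>S\<close> has \<open>m * card H\<close> elements, both bounds are attained.
  Numbering every fibre from \<open>0\<close> to \<open>m - 1\<close>, with \<open>0\<close> given to its unique member in \<open>S0\<close>, and collecting equal
  numbers yields the transversals.
\<close>

lemma ex_transversal_partition:
  assumes H: "add_subgroup H" "H \<subseteq> K" and K: "add_subgroup K" "finite K" "card K = m * card H"
    and S: "finite S" "\<And>\<xi>. \<xi> \<in> S \<Longrightarrow> char_on K \<xi>" "distinct_on K S" "card S = card K"
    and S0: "S0 \<subseteq> S" "distinct_on H S0" "card S0 = card H"
  shows "\<exists>P :: nat \<Rightarrow> ('a::ab_group_add \<Rightarrow> complex) set.
    P 0 = S0 \<and> (\<forall>\<nu><m. P \<nu> \<subseteq> S \<and> distinct_on H (P \<nu>) \<and> card (P \<nu>) = card H) \<and>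
    (\<forall>\<nu> \<mu>. \<nu> \<noteq> \<mu> \<longrightarrow> P \<nu> \<inter> P \<mu> = {}) \<and> (\<Union>\<nu><m. P \<nu>) = S"
proof -
  let ?r = "restrict_char H"
  define R where "R = ?r ` S"
  define C where "C \<theta> = {\<xi> \<in> S. ?r \<xi> = \<theta>}" for \<theta>
  have finH: "finite H" using H K finite_subset by blast
  have cardH: "card H > 0" using finH add_subgroup_zero[OF H(1)] by (auto simp: card_gt_0_iff)
  have "card K \<noteq> 0" using K(2) add_subgroup_zero[OF K(1)] by auto
  then have m: "m > 0" using K(3) by (cases m) auto
  have fin: "finite R" "finite (C \<theta>)" for \<theta> using S(1) by (auto simp: R_def C_def)
  have C_le: "card (C \<theta>) \<le> m" for \<theta>
  proof -
    have "card (C \<theta>) * card H \<le> card K"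
    proof (rule card_chars_agreeing_on_subgroup[OF K(1,2) H fin(2)])
      show "distinct_on K (C \<theta>)" using S(3) by (rule distinct_on_subset) (auto simp: C_def)
      show "\<xi> x = \<eta> x" if "\<xi> \<in> C \<theta>" "\<eta> \<in> C \<theta>" "x \<in> H" for \<xi> \<eta> x
      proof -
        have "?r \<xi> = ?r \<eta>" using that by (simp add: C_def)
        then show ?thesis using that(3) by (simp add: restrict_char_eq_iff)
      qed
    qed (use S(2) in \<open>auto simp: C_def\<close>)
    then show ?thesis using K(3) cardH by simp
  qed
  have "card R \<le> card H"
  proof (rule card_chars_le[OF H(1) finH fin(1)])
    show "char_on H \<theta>" if "\<theta> \<in> R" for \<theta>
      using that S(2) char_on_subset[OF _ H(2)] by (auto simp: R_def intro!: char_on_restrict_char[OF H(1)])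
  qed (simp add: R_def distinct_on_restrict_char_image)
  moreover have r_S0: "inj_on ?r S0" using S0(2) by (simp add: distinct_on_iff_inj_on)
  moreover have "?r ` S0 \<subseteq> R" using S0(1) by (auto simp: R_def)
  ultimately have R: "?r ` S0 = R" "card R = card H"
    using card_image[OF r_S0] S0(3) fin(1) card_seteq[of R "?r ` S0"] by auto
  have "card S = (\<Sum>\<theta>\<in>R. card (C \<theta>))"
  proof -
    have "S = (\<Union>\<theta>\<in>R. C \<theta>)" by (auto simp: R_def C_def)
    also have "card \<dots> = (\<Sum>\<theta>\<in>R. card (C \<theta>))"
      using fin by (intro card_UN_disjoint) (auto simp: C_def)
    finally show ?thesis .
  qed
  then have "(\<Sum>\<theta>\<in>R. card (C \<theta>)) = card R * m"
    using S(4) K(3) R(2) by (metis mult.commute)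
  then have "(\<Sum>\<theta>\<in>R. card (C \<theta>)) = (\<Sum>\<theta>\<in>R. m)" by simp
  then have C_card: "card (C \<theta>) = m" if "\<theta> \<in> R" for \<theta>
    using sum_mono_inv[of "\<lambda>\<theta>. card (C \<theta>)" R "\<lambda>_. m" \<theta>] C_le that fin(1) by simp
  define s where "s = inv_into S0 ?r"
  have s: "s \<theta> \<in> S0" "s \<theta> \<in> C \<theta>" if "\<theta> \<in> R" for \<theta>
    using that R(1) inv_into_into[of \<theta> ?r S0] f_inv_into_f[of \<theta> ?r S0] S0(1)
    by (auto simp: s_def C_def)
  have "\<forall>\<theta>. \<exists>h. \<theta> \<in> R \<longrightarrow> bij_betw h (C \<theta>) {0..<m} \<and> h (s \<theta>) = (0::nat)"
  proof (intro allI)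
    fix \<theta>
    show "\<exists>h. \<theta> \<in> R \<longrightarrow> bij_betw h (C \<theta>) {0..<m} \<and> h (s \<theta>) = (0::nat)"
    proof (cases "\<theta> \<in> R")
      case True
      obtain h where h: "bij_betw h (C \<theta>) {0..<m}"
        using ex_bij_betw_finite_nat[OF fin(2)] C_card[OF True] by metis
      have "h (s \<theta>) \<in> {0..<m}" using h s(2)[OF True] bij_betwE by blast
      then have "bij_betw (Transposition.transpose 0 (h (s \<theta>))) {0..<m} {0..<m}"
        using m by (intro permutes_imp_bij permutes_swap_id) auto
      from bij_betw_trans[OF h this]
      \<comment> \<open>Exchanging two numbers gives \<open>s \<theta>\<close> the number \<open>0\<close>.\<close>
      have "bij_betw (Transposition.transpose 0 (h (s \<theta>)) \<circ> h) (C \<theta>) {0..<m}" .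
      moreover have "(Transposition.transpose 0 (h (s \<theta>)) \<circ> h) (s \<theta>) = 0" by simp
      ultimately show ?thesis by blast
    qed auto
  qed
  from choice[OF this] obtain h where
    h: "\<And>\<theta>. \<theta> \<in> R \<Longrightarrow> bij_betw (h \<theta>) (C \<theta>) {0..<m}" "\<And>\<theta>. \<theta> \<in> R \<Longrightarrow> h \<theta> (s \<theta>) = (0::nat)"
    by blast
  define P where "P \<nu> = {\<xi> \<in> S. h (?r \<xi>) \<xi> = \<nu>}" for \<nu>
  have inC: "?r \<xi> \<in> R" "\<xi> \<in> C (?r \<xi>)" if "\<xi> \<in> S" for \<xi> using that by (auto simp: R_def C_def)
  have "P 0 = S0"
  proof (intro equalityI subsetI)
    fix \<xi> assume "\<xi> \<in> P 0"
    then have \<xi>: "\<xi> \<in> S" "h (?r \<xi>) \<xi> = 0" by (auto simp: P_def)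
    then have "\<xi> = s (?r \<xi>)"
      using inj_onD[OF bij_betw_imp_inj_on[OF h(1)[OF inC(1)[OF \<xi>(1)]]], of \<xi> "s (?r \<xi>)"]
        h(2) s(2) inC[OF \<xi>(1)] by simp
    then show "\<xi> \<in> S0" using s(1) inC(1)[OF \<xi>(1)] by metis
  next
    fix \<xi> assume \<xi>: "\<xi> \<in> S0"
    then have "s (?r \<xi>) = \<xi>" using r_S0 by (simp add: s_def inv_into_f_f)
    then show "\<xi> \<in> P 0" using \<xi> S0(1) h(2)[OF inC(1), of \<xi>] by (auto simp: P_def)
  qed
  moreover have "P \<nu> \<subseteq> S \<and> distinct_on H (P \<nu>) \<and> card (P \<nu>) = card H" if \<nu>: "\<nu> < m" for \<nu>
  proof -
    have inj: "inj_on ?r (P \<nu>)"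
    proof (rule inj_onI)
      fix \<xi> \<eta> assume "\<xi> \<in> P \<nu>" "\<eta> \<in> P \<nu>" and eq: "?r \<xi> = ?r \<eta>"
      then have *: "\<xi> \<in> S" "\<eta> \<in> S" "h (?r \<xi>) \<xi> = h (?r \<xi>) \<eta>" by (auto simp: P_def)
      then show "\<xi> = \<eta>"
        using inj_onD[OF bij_betw_imp_inj_on[OF h(1)[OF inC(1)[OF *(1)]]], of \<xi> \<eta>]
          inC(2)[OF *(1)] inC(2)[OF *(2)] eq by simp
    qed
    have "?r ` P \<nu> = R"
    proof (intro equalityI subsetI)
      fix \<theta> assume \<theta>: "\<theta> \<in> R"
      then have "\<nu> \<in> h \<theta> ` C \<theta>" using h(1)[OF \<theta>] \<nu> by (simp add: bij_betw_def)
      then obtain \<xi> where "\<xi> \<in> C \<theta>" "h \<theta> \<xi> = \<nu>" by auto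
      then show "\<theta> \<in> ?r ` P \<nu>" by (auto simp: C_def P_def)
    qed (auto simp: P_def R_def)
    then have "card (P \<nu>) = card H" using card_image[OF inj] R(2) by simp
    then show ?thesis using inj by (auto simp: P_def distinct_on_iff_inj_on)
  qed
  moreover have "P \<nu> \<inter> P \<mu> = {}" if "\<nu> \<noteq> \<mu>" for \<nu> \<mu> using that by (auto simp: P_def)
  moreover have "(\<Union>\<nu><m. P \<nu>) = S"
  proof (intro equalityI subsetI)
    fix \<xi> assume \<xi>: "\<xi> \<in> S"
    then have "h (?r \<xi>) \<xi> \<in> {0..<m}" using bij_betwE[OF h(1)[OF inC(1)]] inC(2) by blast
    then show "\<xi> \<in> (\<Union>\<nu><m. P \<nu>)" using \<xi> by (auto simp: P_def)
  qed (auto simp: P_def)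
  ultimately show ?thesis by blast
qed

section \<open>Wavelets with minimal support\<close>

text \<open>
  The difference of the two sides has vanishing Fourier coefficients.
\<close>

lemma L2_eq_trig_poly:
  fixes f :: "'a::{topological_ab_group_add, second_countable_topology, t2_space} \<Rightarrow> complex"
  assumes cpt: "compact (UNIV :: 'a set)" and M: "normalized_haar M"
    and sep: "\<And>x::'a. x \<noteq> 0 \<Longrightarrow> \<exists>\<xi>\<in>dual_group. \<xi> x \<noteq> 1"
    and f: "f \<in> L2 M" and fin: "finite (freq_supp M f)"
  shows "AE x in M. f x = trig_poly (freq_supp M f) (fourier_coeff M f) x"
proof -
  let ?S = "freq_supp M f" and ?p = "trig_poly (freq_supp M f) (fourier_coeff M f)"
  have S: "?S \<subseteq> dual_group" by (auto simp: freq_supp_def)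
  have p: "?p \<in> L2 M" by (rule trig_poly_in_L2[OF M S])
  have int: "integrable M f" "integrable M ?p"
    using L2_integrable[OF haar_finite(1)[OF M]] f p by auto
  have "AE x in M. f x - ?p x = 0"
  proof (rule fourier_uniqueness[OF cpt M sep])
    show "integrable M (\<lambda>x. f x - ?p x)" using int by auto
    fix \<xi> :: "'a \<Rightarrow> complex" assume \<xi>: "\<xi> \<in> dual_group"
    have "fourier_coeff M (\<lambda>x. f x - ?p x) \<xi> = fourier_coeff M f \<xi> - fourier_coeff M ?p \<xi>"
      using integrable_mult_cnj_dual[OF M int(1) \<xi>] integrable_mult_cnj_dual[OF M int(2) \<xi>]
      by (simp add: fourier_coeff_def left_diff_distrib)
    also have "\<dots> = 0"
      using fourier_coeff_trig_poly[OF M fin S \<xi>] \<xi> by (auto simp: freq_supp_def)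
    finally show "fourier_coeff M (\<lambda>x. f x - ?p x) \<xi> = 0" .
  qed auto
  then show ?thesis by eventually_elim simp
qed

text \<open>
  Each \<open>\<xi>\<close> in \<open>S\<close> is itself a member of \<open>trig_space M S\<close>, with nonzero coefficient at \<open>\<xi>\<close>.
\<close>

lemma trig_space_mono_imp_subset:
  assumes M: "normalized_haar M" and S: "finite S" "S \<subseteq> dual_group" and T: "finite T" "T \<subseteq> dual_group"
    and sub: "trig_space M S \<subseteq> trig_space M T"
  shows "S \<subseteq> T"
proof
  fix \<xi> assume \<xi>: "\<xi> \<in> S"
  let ?p = "trig_poly S (\<lambda>\<eta>. if \<eta> = \<xi> then 1 else 0)"
  have "?p \<in> trig_space M S" using trig_poly_in_L2[OF M S(2)] by (auto simp: trig_space_iff)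
  then have "?p \<in> trig_space M T" by (rule subsetD[OF sub])
  then obtain c where c: "AE x in M. ?p x = trig_poly T c x" by (auto simp: trig_space_iff)
  have \<xi>': "\<xi> \<in> dual_group" using \<xi> S by auto
  have "fourier_coeff M ?p \<xi> = fourier_coeff M (trig_poly T c) \<xi>"
    by (rule fourier_coeff_cong_AE[OF M trig_poly_measurable[OF M S(2)] trig_poly_measurable[OF M T(2)] c \<xi>'])
  then show "\<xi> \<in> T"
    using fourier_coeff_trig_poly[OF M S \<xi>'] fourier_coeff_trig_poly[OF M T \<xi>'] \<xi> by (auto split: if_splits)
qed

theorem theorem4p6:
  fixes A :: "'a::{topological_ab_group_add, second_countable_topology, t2_space} \<Rightarrow> 'a"
    and M :: "'a measure"
    and V :: "nat \<Rightarrow> ('a \<Rightarrow> complex) set"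
    and m :: nat
  assumes "compact (UNIV :: 'a set)"
    and "normalized_haar M"
    and "continuous_on UNIV A" and "surj A" and "Modules.additive A"
    and "finite (ker_pow A 1)"
    and "closure (\<Union>j. ker_pow A j) = UNIV"
    and "m = card (ker_pow A 1)"
    and "MSF_MRA M A V"
  shows "\<exists>(\<psi> :: nat \<Rightarrow> nat \<Rightarrow> 'a \<Rightarrow> complex) (W :: nat \<Rightarrow> nat \<Rightarrow> ('a \<Rightarrow> complex) set).
           \<forall>j.
             (\<forall>\<nu>\<in>{1..m - 1}.
                \<psi> \<nu> j \<in> L2 M \<and> L2_subspace M (W \<nu> j) \<and>
                L2_orthonormal_basis M (W \<nu> j) (ker_pow A j) (\<lambda>a. translate a (\<psi> \<nu> j)) \<and>
                card (freq_supp M (\<psi> \<nu> j)) = m ^ j) \<and>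
             L2_orthogonal_sum M (V (Suc j)) {0..m - 1} (\<lambda>\<nu>. if \<nu> = 0 then V j else W \<nu> j)"
proof -
  let ?K = "ker_pow A"
  note cpt = assms(1) and M = assms(2)
  have K: "add_subgroup (?K j)" "finite (?K j)" "card (?K j) = m ^ j" for j
    unfolding assms(8) using add_subgroup_ker_pow[OF assms(5)] card_ker_pow[OF assms(5,4,6)] by blast+
  have K_mono: "?K j \<subseteq> ?K (Suc j)" for j
    using ker_pow_mono[OF assms(5)] by (rule incseqD) simp
  have m: "m > 0" 
  proof -
    have "card (?K 1) \<noteq> 0" using K(2)[of 1] add_subgroup_zero[OF K(1), of 1] by auto
    then show ?thesis unfolding assms(8) by simp
  qed
  have sep: "\<exists>\<xi>\<in>dual_group. \<xi> x \<noteq> 1" if "x \<noteq> 0" for x :: 'a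
    by (rule chars_separate_zero[OF cpt that K(1,2) ker_pow_mono[OF assms(5)] assms(7)])
  obtain \<phi> where scaling: "scaling_sequence M A V \<phi>"
    and card_supp: "\<And>j. card (freq_supp M (\<phi> j)) = m ^ j" and mra: "MRA M A V"
    using assms(8,9) unfolding MSF_MRA_def by blast
  have V_L2: "V j \<subseteq> L2 M" and V_mono: "V j \<subseteq> V (Suc j)" for j
    using mra by (auto simp: MRA_def L2_closed_subspace_def L2_subspace_def)
  have \<phi>: "\<phi> j \<in> L2 M" and basis: "L2_basis M (V j) (?K j) (\<lambda>a. translate a (\<phi> j))" for j
    using scaling V_L2 by (auto simp: scaling_sequence_def)
  define S where "S j = freq_supp M (\<phi> j)" for j
  have card_S: "card (S j) = card (?K j)" for j using card_supp K(3) by (simp add: S_def)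
  have S: "finite (S j)" "S j \<subseteq> dual_group" for j
  proof -
    have "card (S j) > 0" using card_S K(3) m by simp
    then show "finite (S j)" by (rule card_ge_0_finite)
    show "S j \<subseteq> dual_group" by (auto simp: S_def freq_supp_def)
  qed
  have \<phi>_trig: "AE x in M. \<phi> j x = trig_poly (S j) (fourier_coeff M (\<phi> j)) x" for j
    unfolding S_def by (rule L2_eq_trig_poly[OF cpt M sep \<phi>]) (use S(1)[of j] in \<open>auto simp: S_def\<close>)
  have dist: "distinct_on (?K j) (S j)" for j
    by (rule independent_translates_imp_distinct_on[OF M S K(1,2) card_S \<phi>_trig])
       (use basis[of j] in \<open>auto simp: L2_basis_def\<close>)
  have V_eq: "V j = trig_space M (S j)" for j
  proof -
    have "V j = L2_span M (?K j) (\<lambda>a. translate a (\<phi> j))" using basis[of j] by (simp add: L2_basis_def)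
    also have "\<dots> = trig_space M (S j)"
      by (rule span_translates_eq_trig_space[OF M S K(1,2) dist \<phi>_trig]) (simp add: S_def freq_supp_def)
    finally show ?thesis .
  qed
  have S_mono: "S j \<subseteq> S (Suc j)" for j
    using V_mono[of j] unfolding V_eq by (rule trig_space_mono_imp_subset[OF M S S])
  have "\<forall>j. \<exists>P :: nat \<Rightarrow> ('a \<Rightarrow> complex) set.
    P 0 = S j \<and> (\<forall>\<nu><m. P \<nu> \<subseteq> S (Suc j) \<and> distinct_on (?K j) (P \<nu>) \<and> card (P \<nu>) = card (?K j)) \<and>
    (\<forall>\<nu> \<mu>. \<nu> \<noteq> \<mu> \<longrightarrow> P \<nu> \<inter> P \<mu> = {}) \<and> (\<Union>\<nu><m. P \<nu>) = S (Suc j)"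
  proof
    fix j
    have "card (?K (Suc j)) = m * card (?K j)" by (simp add: K(3))
    moreover have "char_on (?K (Suc j)) \<xi>" if "\<xi> \<in> S (Suc j)" for \<xi>
      using that S(2) dual_groupD(4) by blast
    ultimately show "\<exists>P :: nat \<Rightarrow> ('a \<Rightarrow> complex) set.
      P 0 = S j \<and> (\<forall>\<nu><m. P \<nu> \<subseteq> S (Suc j) \<and> distinct_on (?K j) (P \<nu>) \<and> card (P \<nu>) = card (?K j)) \<and>
      (\<forall>\<nu> \<mu>. \<nu> \<noteq> \<mu> \<longrightarrow> P \<nu> \<inter> P \<mu> = {}) \<and> (\<Union>\<nu><m. P \<nu>) = S (Suc j)"
      by (intro ex_transversal_partition[OF K(1) K_mono K(1,2) _ S(1) _ dist card_S S_mono dist card_S])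
  qed
  from choice[OF this] obtain P :: "nat \<Rightarrow> nat \<Rightarrow> ('a \<Rightarrow> complex) set" where
    P_all: "\<forall>j. P j 0 = S j \<and>
      (\<forall>\<nu><m. P j \<nu> \<subseteq> S (Suc j) \<and> distinct_on (?K j) (P j \<nu>) \<and> card (P j \<nu>) = card (?K j)) \<and>
      (\<forall>\<nu> \<mu>. \<nu> \<noteq> \<mu> \<longrightarrow> P j \<nu> \<inter> P j \<mu> = {}) \<and> (\<Union>\<nu><m. P j \<nu>) = S (Suc j)"
    by blast
  then have P0: "P j 0 = S j" and P_sub: "\<nu> < m \<Longrightarrow> P j \<nu> \<subseteq> S (Suc j)"
    and P_dist: "\<nu> < m \<Longrightarrow> distinct_on (?K j) (P j \<nu>)" and P_card: "\<nu> < m \<Longrightarrow> card (P j \<nu>) = card (?K j)"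
    and P_disj: "\<nu> \<noteq> \<mu> \<Longrightarrow> P j \<nu> \<inter> P j \<mu> = {}" and P_un: "(\<Union>\<nu><m. P j \<nu>) = S (Suc j)" for j \<nu> \<mu>
    by auto
  have P_fin: "finite (P j \<nu>)" "P j \<nu> \<subseteq> dual_group" if "\<nu> < m" for j \<nu>
    using P_sub[OF that, of j] S[of "Suc j"] by (auto intro: finite_subset)
  define \<psi> where "\<psi> \<nu> j = trig_poly (P j \<nu>) (\<lambda>_. 1 / of_real (sqrt (card (?K j))))" for \<nu> j
  define W where "W \<nu> j = trig_space M (P j \<nu>)" for \<nu> j
  have K_pos: "card (?K j) > 0" for j using K(3) m by simp
  have idx: "{0..m - 1} = {..<m}" using m by auto
  show ?thesis
  proof (intro exI[of _ \<psi>] exI[of _ W] allI conjI ballI)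
    fix j \<nu> assume "\<nu> \<in> {1..m - 1}"
    then have \<nu>: "\<nu> < m" using m by auto
    show \<psi>: "\<psi> \<nu> j \<in> L2 M" unfolding \<psi>_def by (rule trig_poly_in_L2[OF M P_fin(2)[OF \<nu>]])
    show "L2_subspace M (W \<nu> j)" unfolding W_def by (rule trig_space_subspace)
    have "W \<nu> j = L2_span M (?K j) (\<lambda>a. translate a (\<psi> \<nu> j))"
      unfolding W_def
      by (rule span_translates_eq_trig_space[OF M P_fin[OF \<nu>] K(1,2) P_dist[OF \<nu>], symmetric])
         (use K_pos[of j] in \<open>auto simp: \<psi>_def\<close>)
    then show "L2_orthonormal_basis M (W \<nu> j) (?K j) (\<lambda>a. translate a (\<psi> \<nu> j))"
      using K(2) translate_in_L2[OF M \<psi>]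
        orthonormal_translates[OF M P_fin[OF \<nu>] K(1,2) P_dist[OF \<nu>] P_card[OF \<nu>]]
      by (simp add: L2_orthonormal_basis_def \<psi>_def)
    have "freq_supp M (\<psi> \<nu> j) = P j \<nu>"
      unfolding \<psi>_def by (rule freq_supp_trig_poly[OF M P_fin[OF \<nu>]]) (use K_pos[of j] in auto)
    then show "card (freq_supp M (\<psi> \<nu> j)) = m ^ j" using P_card[OF \<nu>] K(3) by simp
  next
    fix j
    have "(\<lambda>\<nu>. if \<nu> = 0 then V j else W \<nu> j) = (\<lambda>\<nu>. trig_space M (P j \<nu>))"
      by (auto simp: fun_eq_iff W_def V_eq P0)
    moreover have "V (Suc j) = trig_space M (\<Union>\<nu>\<in>{..<m}. P j \<nu>)" by (simp only: V_eq P_un)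
    ultimately show "L2_orthogonal_sum M (V (Suc j)) {0..m - 1} (\<lambda>\<nu>. if \<nu> = 0 then V j else W \<nu> j)"
      unfolding idx using trig_space_orthogonal_sum[OF M, of "{..<m}" 0 "P j"] m P_fin P_disj by simp
  qed
qed

end
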